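(* 1. The set of all open ideals of the topological Lie algebra $\widehat{\mathfrak{u}}_\infty$ is equal to the set of all nonzero closed ideals of $\widehat{\mathfrak{u}}_\infty$ and is equal to the set $$\{\widehat{\mathfrak{u}}_\infty,\ \widehat{\mathfrak{u}}_{\infty,n},\ I_{\lambda,n}:=I_\lambda(n)+\widehat{\mathfrak{u}}_{\infty,n+1}\ \mid\ n\ge 2,\ \lambda\in[1,\omega^{n-1})\}.$$ In particular, every nonzero closed ideal $I$ of $\widehat{\mathfrak{u}}_\infty$ contains an ideal $\widehat{\mathfrak{u}}_{\infty,n'+1}$ for some $n'\ge 2$, and, for $I=I_{\lambda,n}$, $n=\min\{n'\ge 2\mid\widehat{\mathfrak{u}}_{\infty,n'+1}\subseteq I\}$. 2. Let $I$ be a nonzero ideal of the Lie algebra $\widehat{\mathfrak{u}}_\infty$. Then $I$ is an open ideal if and only if $I$ is a closed ideal. 3. The topological Lie algebras $\mathfrak{u}_\infty$ and $\widehat{\mathfrak{u}}_\infty$ are Hausdorff. 4. The zero ideal is a closed but not open ideal of the topological Lie algebra $\widehat{\mathfrak{u}}_\infty$.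
   Context: $K$ is a field of characteristic zero, $\mathbb{N}=\{0,1,\ldots\}$, $P_0=K$, $P_i=K[x_1,\ldots,x_i]$, $\partial_i=\partial/\partial x_i$. For $n\ge 2$, $\mathfrak{u}_n=K\partial_1+P_1\partial_2+\cdots+P_{n-1}\partial_n\subseteq\mathrm{Der}_K(P_n)$, and $\mathfrak{u}_\infty=\bigcup_{n\ge 2}\mathfrak{u}_n=\bigoplus_{i\ge 1}P_{i-1}\partial_i$. For $n\ge 1$, $\mathfrak{u}_{\infty,n}=\bigoplus_{j\ge n}P_{j-1}\partial_j$. $\mathfrak{u}_\infty$ is a topological Lie algebra in which the sets $u+\mathfrak{u}_{\infty,n}$ ($u\in\mathfrak{u}_\infty$, $n\ge 1$) form a basis of open sets (equivalently one may use cosets of all nonzero ideals). Its completion is the topological Lie algebra $\widehat{\mathfrak{u}}_\infty=\{\sum_{i\ge 1}a_i\partial_i\mid a_i\in P_{i-1}\}$ of infinite formal sums, with the naturally extended bracket; put $\widehat{\mathfrak{u}}_{\infty,n}=\{\sum_{i\ge n}a_i\partial_i\mid a_i\in P_{i-1}\}$, an ideal of $\widehat{\mathfrak{u}}_\infty$. The sets $a+\widehat{\mathfrak{u}}_{\infty,n}$ ($a\in\widehat{\mathfrak{u}}_\infty$, $n\ge 1$) form a basis of the topology of $\widehat{\mathfrak{u}}_\infty$. An open (closed) ideal is an ideal which is an open (closed) subset. For $n\ge 2$, the set $\{x^\alpha\partial_n\mid\alpha\in\mathbb{N}^{n-1}\}$, $x^\alpha=x_1^{\alpha_1}\cdots x_{n-1}^{\alpha_{n-1}}$,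 is well ordered by: $x^\alpha\partial_n>x^\beta\partial_n$ iff for some $m$ one has $\alpha_m>\beta_m$ and $\alpha_k=\beta_k$ for all $m<k\le n-1$; its order type is $\omega^{n-1}$, where $\omega$ is the first infinite ordinal. Let $\mathrm{ord}(x^\alpha\partial_n)$ be the order type of $\{x^\beta\partial_n\mid x^\beta\partial_n\le x^\alpha\partial_n\}$. For an ordinal $\lambda$ with $1\le\lambda<\omega^{n-1}$, $I_\lambda(n)=\bigoplus\{Kx^\alpha\partial_n\mid\alpha\in\mathbb{N}^{n-1},\ \mathrm{ord}(x^\alpha\partial_n)\le\lambda\}$. *)

theory Defs
  imports
    "HOL-Analysis.Analysis"
    "HOL-Library.Poly_Mapping"
    "HOL-Library.Function_Algebras"
    "HOL-Library.Set_Algebras"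
begin

section \<open>Polynomials in the variables $x_1, x_2, \ldots$\<close>

text \<open>A monomial $x^\alpha$ is given by its exponent vector \<open>\<alpha>\<close>, a finitely supported function
  on the indices of the variables.  Only the indices \<open>\<ge> 1\<close> occur in the sets below.\<close>

type_synonym exponent = "nat \<Rightarrow>\<^sub>0 nat"
type_synonym 'k poly_inf = "exponent \<Rightarrow>\<^sub>0 'k"

definition exponents :: "nat \<Rightarrow> exponent set"
  where "exponents i = {\<alpha>. Poly_Mapping.keys \<alpha> \<subseteq> {1..i}}"

definition P :: "nat \<Rightarrow> 'k::field_char_0 poly_inf set"
  where "P i = {p. Poly_Mapping.keys p \<subseteq> exponents i}"

definition partial :: "nat \<Rightarrow> 'k::field_char_0 poly_inf \<Rightarrow> 'k poly_inf"
  where "partial i p =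
    (\<Sum>\<alpha>\<in>Poly_Mapping.keys p.
      Poly_Mapping.single (\<alpha> - Poly_Mapping.single i 1)
        (of_nat (Poly_Mapping.lookup \<alpha> i) * Poly_Mapping.lookup p \<alpha>))"


section \<open>The Lie algebras\<close>

text \<open>The formal sum $\sum_{i \ge 1} a_i \partial_i$ is encoded as the sequence \<open>a\<close> of its
  coefficients; the entry with index \<open>0\<close> has no meaning and is \<open>0\<close> for all elements of the
  Lie algebras.  Addition is pointwise.\<close>

type_synonym 'k formal_sum = "nat \<Rightarrow> 'k poly_inf"

definition fscale :: "'k::field_char_0 \<Rightarrow> 'k formal_sum \<Rightarrow> 'k formal_sum"
  where "fscale c a = (\<lambda>i. Poly_Mapping.single 0 c * a i)"

interpretation formal: vector_space fscale
  by unfold_locales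
    (auto simp: fscale_def fun_eq_iff algebra_simps mult_single single_add
      simp flip: mult.assoc)

text \<open>The $\partial_j$-coefficient of $[\sum_i a_i \partial_i, \sum_j b_j \partial_j]$ is
  $\sum_i (a_i \partial_i(b_j) - b_i \partial_i(a_j))$.  As $a_j, b_j \in P_{j-1}$, only the
  indices $i < j$ contribute.\<close>

definition bracket :: "'k::field_char_0 formal_sum \<Rightarrow> 'k formal_sum \<Rightarrow> 'k formal_sum"
  where "bracket a b = (\<lambda>j. \<Sum>i\<in>{1..<j}. a i * partial i (b j) - b i * partial i (a j))"

definition u_hat :: "'k::field_char_0 formal_sum set"
  where "u_hat = {a. a 0 = 0 \<and> (\<forall>i\<ge>1. a i \<in> P (i - 1))}"

definition u_hat_from :: "nat \<Rightarrow> 'k::field_char_0 formal_sum set"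
  where "u_hat_from n = {a \<in> u_hat. \<forall>i<n. a i = 0}"

definition u_fin :: "nat \<Rightarrow> 'k::field_char_0 formal_sum set"
  where "u_fin n = {a \<in> u_hat. \<forall>i>n. a i = 0}"

definition u_inf :: "'k::field_char_0 formal_sum set"
  where "u_inf = (\<Union>n\<in>{2..}. u_fin n)"

definition u_inf_from :: "nat \<Rightarrow> 'k::field_char_0 formal_sum set"
  where "u_inf_from n = {a \<in> u_inf. \<forall>i<n. a i = 0}"

definition lie_ideal :: "'k::field_char_0 formal_sum set \<Rightarrow> 'k formal_sum set \<Rightarrow> bool"
  where "lie_ideal L I \<longleftrightarrow>
    I \<subseteq> L \<and> formal.subspace I \<and> (\<forall>a\<in>L. \<forall>b\<in>I. bracket a b \<in> I)"


section \<open>The topologies\<close>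

definition u_hat_top :: "'k::field_char_0 formal_sum topology"
  where "u_hat_top = topology_generated_by {a +o u_hat_from n | a n. a \<in> u_hat \<and> n \<ge> 1}"

definition u_inf_top :: "'k::field_char_0 formal_sum topology"
  where "u_inf_top = topology_generated_by {a +o u_inf_from n | a n. a \<in> u_inf \<and> n \<ge> 1}"


section \<open>Ordinals and the ideals $I_{\lambda,n}$\<close>

text \<open>Ordinals are represented by well-order relations, compared by \<^const>\<open>ordLeq\<close> and
  \<^const>\<open>ordLess\<close>; every countable ordinal, in particular every ordinal below some
  $\omega^k$, is represented by a relation on \<^typ>\<open>nat\<close>.

  \<open>omega_power k\<close> represents $\omega^k$, following $\omega^{k+1} = \omega^k \cdot \omega$: a list
  \<open>a # u\<close> stands for the element \<open>u\<close> of the \<open>a\<close>-th copy of $\omega^k$.\<close>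

primrec omega_power :: "nat \<Rightarrow> nat list rel"
  where
    "omega_power 0 = {([], [])}"
  | "omega_power (Suc k) =
      {(a # u, b # v) | a u b v.
        u \<in> Field (omega_power k) \<and> v \<in> Field (omega_power k) \<and>
        (a < b \<or> a = b \<and> (u, v) \<in> omega_power k)}"

definition ordinals_from_1_below :: "nat list rel \<Rightarrow> nat rel set"
  where "ordinals_from_1_below r = {l. (natLeq_on 1, l) \<in> ordLeq \<and> (l, r) \<in> ordLess}"

definition basis_elt :: "nat \<Rightarrow> exponent \<Rightarrow> 'k::field_char_0 formal_sum"
  where "basis_elt n \<alpha> = (\<lambda>i. if i = n then Poly_Mapping.single \<alpha> 1 else 0)"

text \<open>The order on the elements $x^\alpha \partial_n$ for fixed \<open>n\<close>, as an order on the exponents.\<close>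

definition exp_less :: "nat \<Rightarrow> exponent \<Rightarrow> exponent \<Rightarrow> bool"
  where "exp_less n \<beta> \<alpha> \<longleftrightarrow>
    (\<exists>m\<in>{1..n-1}. Poly_Mapping.lookup \<beta> m < Poly_Mapping.lookup \<alpha> m \<and>
      (\<forall>k. m < k \<and> k \<le> n - 1 \<longrightarrow> Poly_Mapping.lookup \<alpha> k = Poly_Mapping.lookup \<beta> k))"

definition exp_order :: "nat \<Rightarrow> exponent rel"
  where "exp_order n =
    {(\<beta>, \<alpha>). \<beta> \<in> exponents (n - 1) \<and> \<alpha> \<in> exponents (n - 1) \<and> (\<beta> = \<alpha> \<or> exp_less n \<beta> \<alpha>)}"

definition ord_elt :: "nat \<Rightarrow> exponent \<Rightarrow> exponent rel"
  where "ord_elt n \<alpha> = Restr (exp_order n) {\<beta>. (\<beta>, \<alpha>) \<in> exp_order n}"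

definition I_ord :: "nat rel \<Rightarrow> nat \<Rightarrow> 'k::field_char_0 formal_sum set"
  where "I_ord l n =
    formal.span {basis_elt n \<alpha> | \<alpha>. \<alpha> \<in> exponents (n - 1) \<and> (ord_elt n \<alpha>, l) \<in> ordLeq}"

definition I_ideal :: "nat rel \<Rightarrow> nat \<Rightarrow> 'k::field_char_0 formal_sum set"
  where "I_ideal l n = I_ord l n + u_hat_from (n + 1)"

end

theory Submission
  imports Defs
begin

text \<open>Everything rests on one family of subspaces: for a set \<open>D\<close> of exponents in the variables
  \<open>x\<^sub>1, \<dots>, x\<^sub>n\<^sub>-\<^sub>1\<close>, let \<open>lead_ideal n D\<close> be the set of the sums \<open>a\<^sub>n \<partial>\<^sub>n + a\<^sub>n\<^sub>+\<^sub>1 \<partial>\<^sub>n\<^sub>+\<^sub>1 + \<dots>\<close> in which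
  only monomials from \<open>D\<close> occur in \<open>a\<^sub>n\<close>.  The fields \<open>q \<partial>\<^sub>m\<close> with \<open>m < n\<close> make monomials smaller, so
  this is an ideal whenever \<open>D\<close> is an initial segment of the monomials
  (\<open>lie_ideal_lead_ideal\<close>); and it is open, since it contains the tail \<open>u_hat_from (n + 1)\<close>.

  Conversely, every nonzero closed ideal \<open>I\<close> has this form (\<open>closed_ideal_structure\<close>).
  Let \<open>n\<close> be the least index of a nonzero coefficient of an element of \<open>I\<close>, and let \<open>V\<close> be the
  space of the coefficients at \<open>\<partial>\<^sub>n\<close> of the elements of \<open>I\<close>.  The space \<open>V\<close> is stable under all
  \<open>q \<partial>\<^sub>m\<close> with \<open>m < n\<close>.  By \<open>monomials_below_leading\<close>, it contains with a polynomial every monomial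
  up to the leading one, so it is spanned by an initial segment of the monomials
  (\<open>triangular_stable_monomial\<close>).  In particular \<open>1 \<in> V\<close>, that is, \<open>I\<close> contains an element
  \<open>\<partial>\<^sub>n + \<dots>\<close>.  Its brackets with the elements \<open>q \<partial>\<^sub>n\<^sub>+\<^sub>1\<close> realise every polynomial
  as a leading coefficient at \<open>\<partial>\<^sub>n\<^sub>+\<^sub>1\<close>, because polynomials have antiderivatives; repeating this with
  \<open>\<partial>\<^sub>n\<^sub>+\<^sub>1 + \<dots>\<close> shows the same for every later index (\<open>lead_coeffs_above\<close>).  So the
  closure of \<open>I\<close> contains \<open>u_hat_from (n + 1)\<close>, and \<open>I\<close> itself does, being closed.  Hence \<open>I\<close> is
  determined by \<open>V\<close>, and \<open>I\<close> is open.  That open ideals are closed holds for open subgroups of any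
  topological group.

  It remains to compare initial segments with ordinals.  Listing exponents from the last variable
  to the first is an order isomorphism onto the lexicographic order on lists of length \<open>n - 1\<close>, which
  is \<^term>\<open>omega_power (n - 1)\<close> (\<open>exp_order_ordIso\<close>).  The nonempty proper initial segments therefore
  have as order types exactly the ordinals \<open>\<lambda>\<close> from \<open>1\<close> to below \<open>\<omega>\<^sup>n\<^sup>-\<^sup>1\<close>, and the segment of type
  \<open>\<lambda>\<close> consists of the monomials whose own order type is at most \<open>\<lambda>\<close>
  (\<open>exponents_ordLeq_initial\<close>).  So \<open>I_ideal\<close> is an instance of \<open>lead_ideal\<close>, while the
  two improper segments give the tails \<open>u_hat_from\<close>.\<close>

section \<open>Polynomials and their partial derivatives\<close>

lemma lookup_single_mult_add:
  fixes p :: "'a::cancel_comm_monoid_add \<Rightarrow>\<^sub>0 'k::comm_semiring_1"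
  shows "Poly_Mapping.lookup (Poly_Mapping.single \<gamma> c * p) (\<gamma> + \<beta>) = c * Poly_Mapping.lookup p \<beta>"
proof -
  have "(\<Sum>q. Poly_Mapping.lookup p q when \<gamma> + \<beta> = \<gamma> + q) = Poly_Mapping.lookup p \<beta>"
    by simp
  then show ?thesis
    unfolding lookup_mult lookup_single when_mult by simp
qed

lemma lookup_single_0_mult [simp]:
  fixes p :: "'a::cancel_comm_monoid_add \<Rightarrow>\<^sub>0 'k::comm_semiring_1"
  shows "Poly_Mapping.lookup (Poly_Mapping.single 0 c * p) \<beta> = c * Poly_Mapping.lookup p \<beta>"
  using lookup_single_mult_add[of 0 c p \<beta>] by simp

lemma sum_monomials:
  "(\<Sum>\<alpha>\<in>Poly_Mapping.keys p. Poly_Mapping.single \<alpha> (Poly_Mapping.lookup p \<alpha>)) = p"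
  by (rule poly_mapping_eqI)
    (auto simp: lookup_sum lookup_single when_def in_keys_iff)

lemma lookup_partial:
  "Poly_Mapping.lookup (partial i p) \<beta> =
    of_nat (Suc (Poly_Mapping.lookup \<beta> i)) * Poly_Mapping.lookup p (\<beta> + Poly_Mapping.single i 1)"
proof -
  let ?\<beta>' = "\<beta> + Poly_Mapping.single i 1"
  have eq: "Poly_Mapping.lookup (Poly_Mapping.single (\<alpha> - Poly_Mapping.single i 1)
        (of_nat (Poly_Mapping.lookup \<alpha> i) * Poly_Mapping.lookup p \<alpha>)) \<beta> =
      (if \<alpha> = ?\<beta>' then of_nat (Suc (Poly_Mapping.lookup \<beta> i)) * Poly_Mapping.lookup p ?\<beta>' else 0)" for \<alpha>
  proof (cases "Poly_Mapping.lookup \<alpha> i = 0")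
    case True
    then have "\<alpha> \<noteq> ?\<beta>'"
      by (metis add_is_0 lookup_add lookup_single_eq zero_neq_one)
    with True show ?thesis by simp
  next
    case False
    then have "\<alpha> - Poly_Mapping.single i 1 = \<beta> \<longleftrightarrow> \<alpha> = ?\<beta>'"
      by (auto simp: poly_mapping_eq_iff fun_eq_iff lookup_add lookup_minus lookup_single when_def)
    then show ?thesis
      by (auto simp: lookup_single when_def lookup_add)
  qed
  show ?thesis
    unfolding partial_def lookup_sum eq
    by (auto simp: in_keys_iff)
qed

lemma partial_add: "partial i (p + q) = partial i p + partial i q"
  by (rule poly_mapping_eqI) (simp add: lookup_partial lookup_add algebra_simps)

lemma partial_zero [simp]: "partial i 0 = 0"
  by (rule poly_mapping_eqI) (simp add: lookup_partial)

lemma partial_sum: "partial i (sum f A) = (\<Sum>x\<in>A. partial i (f x))"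
  by (induction A rule: infinite_finite_induct) (auto simp: partial_add)

lemma keys_partial:
  assumes "\<beta> \<in> Poly_Mapping.keys (partial i p)"
  shows "\<beta> + Poly_Mapping.single i 1 \<in> Poly_Mapping.keys p"
  using assms by (auto simp: in_keys_iff lookup_partial)

lemma exponents_add: "\<alpha> \<in> exponents i \<Longrightarrow> \<beta> \<in> exponents i \<Longrightarrow> \<alpha> + \<beta> \<in> exponents i"
  using keys_add[of \<alpha> \<beta>] by (auto simp: exponents_def)

lemma exponents_iff: "\<alpha> \<in> exponents i \<longleftrightarrow> (\<forall>k. k \<notin> {1..i} \<longrightarrow> Poly_Mapping.lookup \<alpha> k = 0)"
  by (auto simp: exponents_def in_keys_iff)

lemma exponents_mono: "i \<le> j \<Longrightarrow> exponents i \<subseteq> exponents j"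
  by (auto simp: exponents_iff)

lemma zero_in_exponents [simp]: "0 \<in> exponents i"
  by (simp add: exponents_def)

lemma exponents_eqI:
  assumes "\<alpha> \<in> exponents i" "\<beta> \<in> exponents i"
    "\<And>k. k \<in> {1..i} \<Longrightarrow> Poly_Mapping.lookup \<alpha> k = Poly_Mapping.lookup \<beta> k"
  shows "\<alpha> = \<beta>"
  using assms by (metis exponents_iff poly_mapping_eqI)

lemma zero_in_P [simp]: "0 \<in> P i"
  by (simp add: P_def)

lemma one_in_P [simp]: "1 \<in> P i"
  by (simp add: P_def)

lemma single_in_P: "\<alpha> \<in> exponents i \<Longrightarrow> Poly_Mapping.single \<alpha> c \<in> P i"
  by (auto simp: P_def)

lemma P_mono: "i \<le> j \<Longrightarrow> P i \<subseteq> P j"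
  using exponents_mono by (auto simp: P_def)

lemma P_add: "p \<in> P i \<Longrightarrow> q \<in> P i \<Longrightarrow> p + q \<in> P i"
  using keys_add[of p q] by (auto simp: P_def)

lemma P_mult: "p \<in> P i \<Longrightarrow> q \<in> P i \<Longrightarrow> p * q \<in> P i"
  using keys_mult[of p q] exponents_add by (fastforce simp: P_def)

lemma P_diff: "p \<in> P i \<Longrightarrow> q \<in> P i \<Longrightarrow> p - q \<in> P i"
  using keys_diff[of p q] by (auto simp: P_def)

lemma P_uminus: "p \<in> P i \<Longrightarrow> - p \<in> P i"
  using P_diff[of 0 i p] by simp

lemma P_sum: "(\<And>x. x \<in> A \<Longrightarrow> f x \<in> P i) \<Longrightarrow> sum f A \<in> P i"
  by (induction A rule: infinite_finite_induct) (auto intro: P_add)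

lemma partial_in_P:
  assumes "p \<in> P j"
  shows "partial i p \<in> P j"
proof -
  have "\<beta> \<in> exponents j" if "\<beta> \<in> Poly_Mapping.keys (partial i p)" for \<beta>
    using keys_partial[OF that] assms
    by (auto simp: P_def exponents_iff lookup_add subset_iff)
  then show ?thesis by (auto simp: P_def)
qed

text \<open>Integrating a monomial divides by a positive integer, which needs characteristic zero.\<close>

lemma antiderivative:
  fixes p :: "'k::field_char_0 poly_inf"
  assumes "p \<in> P m" "1 \<le> m"
  obtains q where "q \<in> P m" "partial m q = p"
proof
  let ?c = "\<lambda>\<alpha>. Poly_Mapping.lookup p \<alpha> / of_nat (Suc (Poly_Mapping.lookup \<alpha> m))"
  let ?q = "\<Sum>\<alpha>\<in>Poly_Mapping.keys p. Poly_Mapping.single (\<alpha> + Poly_Mapping.single m 1) (?c \<alpha>)"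
  show "?q \<in> P m"
    using assms by (intro P_sum single_in_P exponents_add) (auto simp: P_def exponents_def)
  have "partial m (Poly_Mapping.single (\<alpha> + Poly_Mapping.single m 1) (?c \<alpha>)) =
      Poly_Mapping.single \<alpha> (Poly_Mapping.lookup p \<alpha>)" for \<alpha>
    by (rule poly_mapping_eqI)
      (auto simp: lookup_partial lookup_single when_def simp del: of_nat_Suc)
  then show "partial m ?q = p"
    by (simp add: partial_sum sum_monomials)
qed

section \<open>The order on monomials\<close>

text \<open>Listing the exponents from the last variable to the first turns the order on the monomials
  \<open>x\<^sup>\<alpha> \<partial>\<^sub>n\<close> into the lexicographic order on lists, which is that of \<^const>\<open>omega_power\<close>.\<close>

primrec exponent_list :: "nat \<Rightarrow> exponent \<Rightarrow> nat list"
  where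
    "exponent_list 0 \<alpha> = []"
  | "exponent_list (Suc k) \<alpha> = Poly_Mapping.lookup \<alpha> (Suc k) # exponent_list k \<alpha>"

lemma length_exponent_list [simp]: "length (exponent_list k \<alpha>) = k"
  by (induction k) auto

lemma exponent_list_eq_iff:
  "exponent_list k \<alpha> = exponent_list k \<beta> \<longleftrightarrow>
    (\<forall>j\<in>{1..k}. Poly_Mapping.lookup \<alpha> j = Poly_Mapping.lookup \<beta> j)"
  by (induction k) (auto simp: atLeastAtMostSuc_conv)

text \<open>Unlike the defining equation of \<^const>\<open>lexn\<close>, this rule contains no images of pairs, so the
  simplifier can use it.\<close>

lemma lexn_Cons:
  "(x # xs, y # ys) \<in> lexn r (Suc n) \<longleftrightarrow>
    length xs = n \<and> length ys = n \<and> ((x, y) \<in> r \<or> x = y \<and> (xs, ys) \<in> lexn r n)"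
proof -
  have "(x # xs, y # ys) = map_prod (\<lambda>(x, xs). x # xs) (\<lambda>(x, xs). x # xs) z \<longleftrightarrow>
      z = ((x, xs), (y, ys))" for z
    by (cases z) auto
  then show ?thesis
    unfolding lexn.simps Int_iff image_iff by (auto dest: lexn_length)
qed

declare lexn.simps(2) [simp del]

lemma exponent_list_lexn:
  "(exponent_list k \<beta>, exponent_list k \<alpha>) \<in> lexn less_than k \<longleftrightarrow>
    (\<exists>m\<in>{1..k}. Poly_Mapping.lookup \<beta> m < Poly_Mapping.lookup \<alpha> m \<and>
      (\<forall>j. m < j \<and> j \<le> k \<longrightarrow> Poly_Mapping.lookup \<alpha> j = Poly_Mapping.lookup \<beta> j))"
  (is "_ \<longleftrightarrow> (\<exists>m\<in>{1..k}. ?Q m \<and> (\<forall>j. m < j \<and> j \<le> k \<longrightarrow> ?R j))")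
proof (induction k)
  case (Suc k)
  have 1: "(exponent_list (Suc k) \<beta>, exponent_list (Suc k) \<alpha>) \<in> lexn less_than (Suc k) \<longleftrightarrow>
      ?Q (Suc k) \<or> ?R (Suc k) \<and> (exponent_list k \<beta>, exponent_list k \<alpha>) \<in> lexn less_than k"
    by (auto simp: lexn_Cons)
  have "(\<forall>j. m < j \<and> j \<le> Suc k \<longrightarrow> ?R j) \<longleftrightarrow>
      ?R (Suc k) \<and> (\<forall>j. m < j \<and> j \<le> k \<longrightarrow> ?R j)" if "m \<in> {1..k}" for m
    using that by (auto simp: le_Suc_eq)
  then have 2: "(\<exists>m\<in>{1..Suc k}. ?Q m \<and> (\<forall>j. m < j \<and> j \<le> Suc k \<longrightarrow> ?R j)) \<longleftrightarrow>
      ?Q (Suc k) \<or> ?R (Suc k) \<and> (\<exists>m\<in>{1..k}. ?Q m \<and> (\<forall>j. m < j \<and> j \<le> k \<longrightarrow> ?R j))"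
    by (simp add: atLeastAtMostSuc_conv) blast
  show ?case
    unfolding 1 2 Suc.IH ..
qed auto

lemma exponent_list_bij: "bij_betw (exponent_list k) (exponents k) {u. length u = k}"
  unfolding bij_betw_def
proof
  show "inj_on (exponent_list k) (exponents k)"
    by (auto simp: inj_on_def exponent_list_eq_iff intro: exponents_eqI)
  have "\<exists>\<alpha>\<in>exponents k. u = exponent_list k \<alpha>" if "length u = k" for u
    using that
  proof (induction k arbitrary: u)
    case 0
    then show ?case by (intro bexI[of _ 0]) simp_all
  next
    case (Suc k)
    then obtain a v where u: "u = a # v" "length v = k" by (cases u) auto
    with Suc obtain \<alpha> where \<alpha>: "\<alpha> \<in> exponents k" "v = exponent_list k \<alpha>" by blast
    let ?\<alpha> = "\<alpha> + Poly_Mapping.single (Suc k) a"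
    have "?\<alpha> \<in> exponents (Suc k)" "u = exponent_list (Suc k) ?\<alpha>"
      using \<alpha> u by (auto simp: exponents_iff lookup_add lookup_single when_def exponent_list_eq_iff)
    then show ?case by blast
  qed
  then show "exponent_list k ` exponents k = {u. length u = k}" by auto
qed

lemma omega_power_eq_lexn:
  "omega_power k = {(u, v). length u = k \<and> length v = k \<and> (u = v \<or> (u, v) \<in> lexn less_than k)}"
proof (induction k)
  case (Suc k)
  have F: "Field (omega_power k) = {u. length u = k}"
    unfolding Suc by (auto simp: Field_def)
  have "(u, v) \<in> omega_power (Suc k) \<longleftrightarrow> length u = Suc k \<and> length v = Suc k \<and>
      (u = v \<or> (u, v) \<in> lexn less_than (Suc k))" for u v
    unfolding omega_power.simps F unfolding Suc
    by (cases u; cases v) (auto simp: lexn_Cons)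
  then show ?case
    by (auto simp del: omega_power.simps)
qed auto

lemma Field_omega_power: "Field (omega_power k) = {u. length u = k}"
  unfolding omega_power_eq_lexn by (auto simp: Field_def)

lemma Well_order_omega_power: "Well_order (omega_power k)"
proof -
  have tr: "trans (lexn less_than k)" by (rule lexn_transI) simp
  have wf: "wf (lexn less_than k)" by (rule wf_lexn) simp
  have "(u, v) \<in> lexn less_than k \<or> (v, u) \<in> lexn less_than k"
    if "length u = k" "length v = k" "u \<noteq> v" for u v :: "nat list"
    using that
  proof (induction k arbitrary: u v)
    case (Suc k)
    then obtain a u' b v' where "u = a # u'" "v = b # v'" "length u' = k" "length v' = k"
      by (cases u; cases v) auto
    with Suc show ?case
      using linorder_less_linear[of a b] by (auto simp: lexn_Cons)
  qed auto
  moreover have "wf (omega_power k - Id)"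
    by (rule wf_subset[OF wf]) (auto simp: omega_power_eq_lexn)
  moreover have "trans (omega_power k)"
    using tr unfolding trans_def omega_power_eq_lexn by blast
  moreover have "antisym (omega_power k)"
    using wf_not_sym[OF wf] by (auto simp: antisym_def omega_power_eq_lexn)
  ultimately show ?thesis
    unfolding well_order_on_def linear_order_on_def partial_order_on_def preorder_on_def
      Field_omega_power
    by (auto simp: refl_on_def total_on_def omega_power_eq_lexn)
qed

lemma exp_order_eq:
  "exp_order n = {(\<beta>, \<alpha>). \<beta> \<in> exponents (n - 1) \<and> \<alpha> \<in> exponents (n - 1) \<and>
    (exponent_list (n - 1) \<beta>, exponent_list (n - 1) \<alpha>) \<in> omega_power (n - 1)}"
  using inj_onD[OF bij_betw_imp_inj_on[OF exponent_list_bij]]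
  by (auto simp: exp_order_def omega_power_eq_lexn exp_less_def exponent_list_lexn)

lemma exp_order_dir_image:
  "exp_order n = dir_image (omega_power (n - 1)) (inv_into (exponents (n - 1)) (exponent_list (n - 1)))"
    (is "_ = dir_image _ ?g")
proof -
  note bij = exponent_list_bij[of "n - 1"]
  have "?g u \<in> exponents (n - 1)" "exponent_list (n - 1) (?g u) = u" if "length u = n - 1" for u
    using that bij by (auto simp: bij_betw_def intro!: inv_into_into f_inv_into_f)
  moreover have "?g (exponent_list (n - 1) \<alpha>) = \<alpha>" if "\<alpha> \<in> exponents (n - 1)" for \<alpha>
    using that bij by (simp add: bij_betw_def)
  moreover have "length u = n - 1 \<and> length v = n - 1" if "(u, v) \<in> omega_power (n - 1)" for u v
    using that by (simp add: omega_power_eq_lexn)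
  ultimately show ?thesis
    unfolding exp_order_eq dir_image_def by (auto; metis)
qed

lemma inj_on_exponent_of_list:
  "inj_on (inv_into (exponents k) (exponent_list k)) (Field (omega_power k))"
  using bij_betw_inv_into[OF exponent_list_bij[of k]]
  by (simp add: bij_betw_def Field_omega_power)

lemma Well_order_exp_order: "Well_order (exp_order n)"
  unfolding exp_order_dir_image
  by (rule Well_order_dir_image[OF Well_order_omega_power inj_on_exponent_of_list])

lemma exp_order_ordIso: "(exp_order n, omega_power (n - 1)) \<in> ordIso"
  unfolding exp_order_dir_image
  by (rule ordIso_symmetric[OF dir_image_ordIso[OF Well_order_omega_power inj_on_exponent_of_list]])

lemma Field_exp_order: "Field (exp_order n) = exponents (n - 1)"
  by (auto simp: exp_order_def Field_def)

lemma wo_rel_exp_order: "wo_rel (exp_order n)"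
  unfolding wo_rel_def by (rule Well_order_exp_order)

lemma exp_order_total:
  assumes "\<alpha> \<in> exponents (n - 1)" "\<beta> \<in> exponents (n - 1)"
  shows "(\<alpha>, \<beta>) \<in> exp_order n \<or> (\<beta>, \<alpha>) \<in> exp_order n"
  using wo_rel.TOTALS[OF wo_rel_exp_order, unfolded Field_exp_order] assms by blast

lemma exp_order_trans: "(\<alpha>, \<beta>) \<in> exp_order n \<Longrightarrow> (\<beta>, \<gamma>) \<in> exp_order n \<Longrightarrow> (\<alpha>, \<gamma>) \<in> exp_order n"
  by (rule transD[OF wo_rel.TRANS[OF wo_rel_exp_order]])

lemma exp_less_irrefl: "\<not> exp_less n \<alpha> \<alpha>"
  by (auto simp: exp_less_def)

lemma exp_less_induct [consumes 1, case_names less]: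
  assumes "\<alpha> \<in> exponents (n - 1)"
    and "\<And>\<alpha>. \<alpha> \<in> exponents (n - 1) \<Longrightarrow>
      (\<And>\<beta>. \<beta> \<in> exponents (n - 1) \<Longrightarrow> exp_less n \<beta> \<alpha> \<Longrightarrow> Q \<beta>) \<Longrightarrow> Q \<alpha>"
  shows "Q \<alpha>"
proof -
  have "wf (exp_order n - Id)"
    using Well_order_exp_order[of n] by (simp add: well_order_on_def)
  then show ?thesis
    using assms(1)
  proof (induction \<alpha> rule: wf_induct_rule)
    case (less \<alpha>)
    show ?case
    proof (rule assms(2)[OF less.prems])
      fix \<beta> assume "\<beta> \<in> exponents (n - 1)" "exp_less n \<beta> \<alpha>"
      then show "Q \<beta>"
        using less.prems exp_less_irrefl by (intro less.IH) (auto simp: exp_order_def)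
    qed
  qed
qed

abbreviation initial :: "nat \<Rightarrow> exponent set \<Rightarrow> bool"
  where "initial n D \<equiv> wo_rel.ofilter (exp_order n) D"

lemma initial_iff:
  "initial n D \<longleftrightarrow> D \<subseteq> exponents (n - 1) \<and>
    (\<forall>\<alpha>\<in>D. \<forall>\<beta>\<in>exponents (n - 1). exp_less n \<beta> \<alpha> \<longrightarrow> \<beta> \<in> D)"
  unfolding wo_rel.ofilter_def[OF wo_rel_exp_order] Field_exp_order
  by (auto simp: under_def exp_order_def)

lemma initialD: "initial n D \<Longrightarrow> \<alpha> \<in> D \<Longrightarrow> (\<beta>, \<alpha>) \<in> exp_order n \<Longrightarrow> \<beta> \<in> D"
  unfolding wo_rel.ofilter_def[OF wo_rel_exp_order] by (auto simp: under_def)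

lemma initial_exponents: "initial n (exponents (n - 1))"
  by (simp add: initial_iff)

text \<open>The field \<open>q \<partial>\<^sub>m\<close> sends a monomial to a combination of smaller ones, as it lowers the
  exponent of \<open>x\<^sub>m\<close> and raises at most the exponents of earlier variables.\<close>

lemma exp_less_shift:
  assumes "1 \<le> m" "m \<le> n - 1" "\<gamma> \<in> exponents (m - 1)" "Poly_Mapping.lookup \<alpha> m \<noteq> 0"
  shows "exp_less n (\<gamma> + (\<alpha> - Poly_Mapping.single m 1)) \<alpha>"
  unfolding exp_less_def using assms
  by (intro bexI[of _ m]) (auto simp: lookup_add lookup_minus lookup_single when_def exponents_iff)

lemma shift_in_exponents:
  assumes "1 \<le> m" "m \<le> k" "\<gamma> \<in> exponents (m - 1)" "\<alpha> \<in> exponents k"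
  shows "\<gamma> + (\<alpha> - Poly_Mapping.single m 1) \<in> exponents k"
  using assms by (auto simp: lookup_add lookup_minus lookup_single when_def exponents_iff)

text \<open>The map \<open>x\<^sup>\<gamma> \<partial>\<^sub>m\<close> keeps the order of the monomials that it does not kill, so it sends a leading
  monomial that it does not kill to a leading monomial.\<close>

lemma exp_less_shift_mono:
  assumes "exp_less n \<delta> \<alpha>" "Poly_Mapping.lookup \<delta> m \<noteq> 0"
  shows "exp_less n (\<gamma> + (\<delta> - Poly_Mapping.single m 1)) (\<gamma> + (\<alpha> - Poly_Mapping.single m 1))"
proof -
  from assms(1) obtain k where k: "k \<in> {1..n-1}" "Poly_Mapping.lookup \<delta> k < Poly_Mapping.lookup \<alpha> k"
    "\<forall>j. k < j \<and> j \<le> n - 1 \<longrightarrow> Poly_Mapping.lookup \<alpha> j = Poly_Mapping.lookup \<delta> j"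
    by (auto simp: exp_less_def)
  show ?thesis
    unfolding exp_less_def
    using k assms(2)
    by (intro bexI[OF _ k(1)]) (auto simp: lookup_add lookup_minus lookup_single when_def)
qed

lemma keys_mult_partial:
  assumes "\<beta> \<in> Poly_Mapping.keys (q * partial m p)"
  obtains \<gamma> \<delta> where "\<gamma> \<in> Poly_Mapping.keys q" "\<delta> \<in> Poly_Mapping.keys p"
    "Poly_Mapping.lookup \<delta> m \<noteq> 0" "\<beta> = \<gamma> + (\<delta> - Poly_Mapping.single m 1)"
proof -
  obtain \<gamma> \<delta> where *: "\<gamma> \<in> Poly_Mapping.keys q" "\<delta> \<in> Poly_Mapping.keys (partial m p)" "\<beta> = \<gamma> + \<delta>"
    using assms keys_mult by blast
  show thesis
    using keys_partial[OF *(2)] *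
    by (intro that[of \<gamma> "\<delta> + Poly_Mapping.single m 1"]) (auto simp: lookup_add)
qed

section \<open>Subspaces stable under the triangular fields\<close>

definition triangular_stable :: "nat \<Rightarrow> 'k::field_char_0 poly_inf set \<Rightarrow> bool"
  where "triangular_stable n V \<longleftrightarrow> V \<subseteq> P (n - 1) \<and> 0 \<in> V \<and>
    (\<forall>f\<in>V. \<forall>g\<in>V. f + g \<in> V) \<and> (\<forall>c. \<forall>f\<in>V. Poly_Mapping.single 0 c * f \<in> V) \<and>
    (\<forall>m q f. 1 \<le> m \<longrightarrow> m \<le> n - 1 \<longrightarrow> q \<in> P (m - 1) \<longrightarrow> f \<in> V \<longrightarrow> q * partial m f \<in> V)"

lemma triangular_stable_sum:
  assumes "triangular_stable n V" "\<And>x. x \<in> A \<Longrightarrow> f x \<in> V"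
  shows "sum f A \<in> V"
  using assms(2)
  by (induction A rule: infinite_finite_induct) (use assms(1) in \<open>auto simp: triangular_stable_def\<close>)

lemma triangular_stable_single:
  assumes "triangular_stable n V" "Poly_Mapping.single \<beta> c \<in> V" "c \<noteq> 0"
  shows "Poly_Mapping.single \<beta> d \<in> V"
proof -
  have "Poly_Mapping.single 0 (d / c) * Poly_Mapping.single \<beta> c \<in> V"
    using assms by (auto simp: triangular_stable_def)
  then show ?thesis using assms(3) by (simp add: mult_single)
qed

lemma exists_leading_exponent:
  assumes "f \<in> P (n - 1)" "f \<noteq> 0"
  obtains \<alpha> where "\<alpha> \<in> Poly_Mapping.keys f"
    "\<And>\<beta>. \<beta> \<in> Poly_Mapping.keys f \<Longrightarrow> (\<beta>, \<alpha>) \<in> exp_order n"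
proof -
  have "\<exists>\<alpha>\<in>A. \<forall>\<beta>\<in>A. (\<beta>, \<alpha>) \<in> exp_order n" if "finite A" "A \<noteq> {}" "A \<subseteq> exponents (n - 1)" for A
    using that
  proof (induction A rule: finite_ne_induct)
    case (singleton x)
    then show ?case by (auto simp: exp_order_def)
  next
    case (insert x A)
    then obtain \<alpha> where \<alpha>: "\<alpha> \<in> A" "\<forall>\<beta>\<in>A. (\<beta>, \<alpha>) \<in> exp_order n" by auto
    have "x \<in> exponents (n - 1)" "\<alpha> \<in> exponents (n - 1)"
      using insert \<alpha> by auto
    then consider "(x, \<alpha>) \<in> exp_order n" | "(\<alpha>, x) \<in> exp_order n" "(x, x) \<in> exp_order n"
      using exp_order_total by blast
    then show ?case
    proof cases
      case 1
      then show ?thesis using \<alpha> by auto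
    next
      case 2
      then show ?thesis using \<alpha> exp_order_trans by blast
    qed
  qed
  moreover have "Poly_Mapping.keys f \<noteq> {}" "Poly_Mapping.keys f \<subseteq> exponents (n - 1)"
    using assms by (auto simp: P_def)
  ultimately show thesis using that by (meson finite_keys)
qed

text \<open>Let \<open>x\<^sup>\<alpha>\<close> be the leading monomial of \<open>f\<close> and let \<open>x\<^sup>\<beta>\<close> be smaller, with \<open>m\<close> the last variable in
  which they differ.  For \<open>\<gamma> = (\<beta>\<^sub>1, \<dots>, \<beta>\<^sub>m\<^sub>-\<^sub>1)\<close>, the leading exponent
  \<open>\<alpha> - e\<^sub>m + \<gamma>\<close> of \<open>x\<^sup>\<gamma> \<partial>\<^sub>m f\<close> lies between \<open>\<beta>\<close> and \<open>\<alpha>\<close>, the latter excluded; its coefficient is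
  nonzero in characteristic zero.  Induction along the well-order therefore puts \<open>x\<^sup>\<beta>\<close> into
  the subspace.\<close>

lemma monomials_below_leading:
  fixes V :: "'k::field_char_0 poly_inf set"
  assumes V: "triangular_stable n V"
    and "\<alpha> \<in> exponents (n - 1)" "f \<in> V" "\<alpha> \<in> Poly_Mapping.keys f"
    and "\<And>\<delta>. \<delta> \<in> Poly_Mapping.keys f \<Longrightarrow> (\<delta>, \<alpha>) \<in> exp_order n"
    and "(\<beta>, \<alpha>) \<in> exp_order n"
  shows "Poly_Mapping.single \<beta> 1 \<in> V"
  using assms(2-)
proof (induction \<alpha> arbitrary: f \<beta> rule: exp_less_induct)
  case (less \<alpha>)
  have below: "Poly_Mapping.single \<beta> 1 \<in> V" if \<beta>: "\<beta> \<in> exponents (n - 1)" and "exp_less n \<beta> \<alpha>" for \<beta>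
  proof -
    from \<open>exp_less n \<beta> \<alpha>\<close> obtain m where m: "1 \<le> m" "m \<le> n - 1"
      and \<beta>m: "Poly_Mapping.lookup \<beta> m < Poly_Mapping.lookup \<alpha> m"
      and above: "\<And>k. m < k \<Longrightarrow> k \<le> n - 1 \<Longrightarrow> Poly_Mapping.lookup \<alpha> k = Poly_Mapping.lookup \<beta> k"
      by (auto simp: exp_less_def)
    obtain \<gamma> :: exponent where \<gamma>: "Poly_Mapping.lookup \<gamma> = (\<lambda>k. if k < m then Poly_Mapping.lookup \<beta> k else 0)"
    proof
      have "finite {k. (if k < m then Poly_Mapping.lookup \<beta> k else 0) \<noteq> 0}"
        by (rule finite_subset[of _ "{..<m}"]) auto
      then show "Poly_Mapping.lookup (Abs_poly_mapping (\<lambda>k. if k < m then Poly_Mapping.lookup \<beta> k else 0)) =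
          (\<lambda>k. if k < m then Poly_Mapping.lookup \<beta> k else 0)"
        by (rule lookup_Abs_poly_mapping)
    qed
    have \<gamma>E: "\<gamma> \<in> exponents (m - 1)"
      using \<beta> by (auto simp: exponents_iff \<gamma>)
    let ?shift = "\<lambda>\<delta>. \<gamma> + (\<delta> - Poly_Mapping.single m 1)"
    let ?g = "Poly_Mapping.single \<gamma> 1 * partial m f"
    have "?g \<in> V"
      using V m less.prems(1) single_in_P[OF \<gamma>E, of "1::'k"] by (auto simp: triangular_stable_def)
    moreover have \<alpha>': "?shift \<alpha> \<in> exponents (n - 1)"
      by (rule shift_in_exponents) (use m \<gamma>E less.hyps in auto)
    moreover have "exp_less n (?shift \<alpha>) \<alpha>"
      by (rule exp_less_shift) (use m \<gamma>E \<beta>m in auto)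
    moreover have "?shift \<alpha> \<in> Poly_Mapping.keys ?g"
    proof -
      have "\<alpha> - Poly_Mapping.single m 1 + Poly_Mapping.single m 1 = \<alpha>"
        using \<beta>m by (auto simp: poly_mapping_eq_iff fun_eq_iff lookup_add lookup_minus lookup_single when_def)
      then show ?thesis
        using less.prems(2) by (simp add: in_keys_iff lookup_single_mult_add lookup_partial del: of_nat_Suc)
    qed
    moreover have "(\<epsilon>, ?shift \<alpha>) \<in> exp_order n" if \<epsilon>: "\<epsilon> \<in> Poly_Mapping.keys ?g" for \<epsilon>
    proof -
      obtain \<delta> where \<delta>: "\<delta> \<in> Poly_Mapping.keys f" "Poly_Mapping.lookup \<delta> m \<noteq> 0" "\<epsilon> = ?shift \<delta>"
        using keys_mult_partial[OF \<epsilon>] by auto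
      then have "\<delta> \<in> exponents (n - 1)" "\<delta> = \<alpha> \<or> exp_less n \<delta> \<alpha>"
        using less.prems(3) by (auto simp: exp_order_def)
      moreover have "\<epsilon> \<in> exponents (n - 1)"
        unfolding \<delta>(3) by (rule shift_in_exponents) (use m \<gamma>E calculation in auto)
      ultimately show ?thesis
        using \<alpha>' \<delta> exp_less_shift_mono by (auto simp: exp_order_def)
    qed
    moreover have "(\<beta>, ?shift \<alpha>) \<in> exp_order n"
    proof -
      have "\<not> exp_less n (?shift \<alpha>) \<beta>"
      proof
        assume "exp_less n (?shift \<alpha>) \<beta>"
        then obtain k where k: "k \<in> {1..n-1}"
          "Poly_Mapping.lookup (?shift \<alpha>) k < Poly_Mapping.lookup \<beta> k"
          by (auto simp: exp_less_def)
        then show False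
          using \<beta>m above[of k]
          by (cases k m rule: linorder_cases) (auto simp: lookup_add lookup_minus lookup_single when_def \<gamma>)
      qed
      then show ?thesis
        using exp_order_total[OF \<beta> \<alpha>'] by (auto simp: exp_order_def)
    qed
    ultimately show ?thesis
      using less.IH[of "?shift \<alpha>" ?g \<beta>] by blast
  qed
  show ?case
  proof (cases "\<beta> = \<alpha>")
    case False
    with less.prems(4) below show ?thesis by (auto simp: exp_order_def)
  next
    case True
    \<comment> \<open>All lower terms of \<open>f\<close> are in \<open>V\<close> already, so what remains of \<open>f\<close> is its leading term.\<close>
    let ?c = "Poly_Mapping.lookup f"
    have tail: "Poly_Mapping.single \<delta> (- ?c \<delta>) \<in> V" if "\<delta> \<in> Poly_Mapping.keys f - {\<alpha>}" for \<delta>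
    proof -
      have "Poly_Mapping.single \<delta> 1 \<in> V"
        using that less.prems(3)[of \<delta>] below by (auto simp: exp_order_def)
      then show ?thesis
        using triangular_stable_single[OF V] by fastforce
    qed
    have "f = Poly_Mapping.single \<alpha> (?c \<alpha>) + (\<Sum>\<delta>\<in>Poly_Mapping.keys f - {\<alpha>}. Poly_Mapping.single \<delta> (?c \<delta>))"
      using sum_monomials[of f] less.prems(2) by (simp add: sum.remove)
    then have "Poly_Mapping.single \<alpha> (?c \<alpha>) =
        f + (\<Sum>\<delta>\<in>Poly_Mapping.keys f - {\<alpha>}. Poly_Mapping.single \<delta> (- ?c \<delta>))"
      by (simp add: single_uminus sum_negf algebra_simps)
    moreover have "\<dots> \<in> V"
      using V less.prems(1) triangular_stable_sum[OF V, of "Poly_Mapping.keys f - {\<alpha>}"] tail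
      by (auto simp: triangular_stable_def)
    ultimately have "Poly_Mapping.single \<alpha> (?c \<alpha>) \<in> V" by simp
    then show ?thesis
      using triangular_stable_single[OF V] less.prems(2) True by (auto simp: in_keys_iff)
  qed
qed

text \<open>Any key \<open>\<alpha>\<close> of any element lies below the leading exponent of that element, so all monomials up
  to \<open>x\<^sup>\<alpha>\<close> belong to the subspace.\<close>

lemma triangular_stable_monomial:
  fixes V :: "'k::field_char_0 poly_inf set"
  assumes V: "triangular_stable n V"
  defines "D \<equiv> {\<alpha> \<in> exponents (n - 1). Poly_Mapping.single \<alpha> 1 \<in> V}"
  shows "initial n D" "V = {f. Poly_Mapping.keys f \<subseteq> D}"
proof -
  have key: "Poly_Mapping.single \<beta> 1 \<in> V"
    if "f \<in> V" "\<alpha> \<in> Poly_Mapping.keys f" "(\<beta>, \<alpha>) \<in> exp_order n" for f \<alpha> \<beta>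
  proof -
    have "f \<in> P (n - 1)" "f \<noteq> 0"
      using V that by (auto simp: triangular_stable_def)
    then obtain \<alpha>' where "\<alpha>' \<in> Poly_Mapping.keys f"
      "\<And>\<delta>. \<delta> \<in> Poly_Mapping.keys f \<Longrightarrow> (\<delta>, \<alpha>') \<in> exp_order n"
      using exists_leading_exponent by blast
    moreover have "(\<beta>, \<alpha>') \<in> exp_order n"
      using calculation that exp_order_trans by blast
    ultimately show ?thesis
      using monomials_below_leading[OF V _ \<open>f \<in> V\<close>] by (auto simp: exp_order_def)
  qed
  show "initial n D"
    unfolding initial_iff
  proof (intro conjI ballI impI)
    fix \<alpha> \<beta>
    assume "\<alpha> \<in> D" "\<beta> \<in> exponents (n - 1)" "exp_less n \<beta> \<alpha>"
    then show "\<beta> \<in> D"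
      using key[of "Poly_Mapping.single \<alpha> 1" \<alpha> \<beta>] by (auto simp: D_def exp_order_def)
  qed (auto simp: D_def)
  show "V = {f. Poly_Mapping.keys f \<subseteq> D}"
  proof (intro set_eqI iffI CollectI)
    fix f assume f: "f \<in> V"
    show "Poly_Mapping.keys f \<subseteq> D"
    proof
      fix \<alpha> assume \<alpha>: "\<alpha> \<in> Poly_Mapping.keys f"
      then have "\<alpha> \<in> exponents (n - 1)"
        using V f by (auto simp: triangular_stable_def P_def)
      then show "\<alpha> \<in> D"
        using key[OF f \<alpha>, of \<alpha>] by (auto simp: D_def exp_order_def)
    qed
  next
    fix f :: "'k poly_inf" assume "f \<in> {f. Poly_Mapping.keys f \<subseteq> D}"
    then have "Poly_Mapping.single \<alpha> (Poly_Mapping.lookup f \<alpha>) \<in> V" if "\<alpha> \<in> Poly_Mapping.keys f" for \<alpha>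
      using that triangular_stable_single[OF V, of \<alpha> 1] by (auto simp: D_def)
    then have "(\<Sum>\<alpha>\<in>Poly_Mapping.keys f. Poly_Mapping.single \<alpha> (Poly_Mapping.lookup f \<alpha>)) \<in> V"
      by (rule triangular_stable_sum[OF V])
    then show "f \<in> V" by (simp add: sum_monomials)
  qed
qed

section \<open>Groups topologised by a filtration\<close>

text \<open>Both Lie algebras carry a topology of this kind.\<close>

locale filtered_group =
  fixes U :: "'a::ab_group_add set" and F :: "nat \<Rightarrow> 'a set"
  assumes U_add: "\<And>a b. a \<in> U \<Longrightarrow> b \<in> U \<Longrightarrow> a + b \<in> U"
    and F_subset: "\<And>n. F n \<subseteq> U"
    and F_zero: "\<And>n. 0 \<in> F n"
    and F_add: "\<And>n a b. a \<in> F n \<Longrightarrow> b \<in> F n \<Longrightarrow> a + b \<in> F n"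
    and F_uminus: "\<And>n a. a \<in> F n \<Longrightarrow> - a \<in> F n"
    and F_antimono: "\<And>m n. m \<le> n \<Longrightarrow> F n \<subseteq> F m"
begin

definition filtration_topology :: "'a topology"
  where "filtration_topology = topology_generated_by {a +o F n | a n. a \<in> U \<and> n \<ge> 1}"

lemma coset_iff: "x \<in> a +o F n \<longleftrightarrow> x - a \<in> F n"
proof -
  have "x = a + b \<longleftrightarrow> b = x - a" for b
    by (auto simp: algebra_simps)
  then show ?thesis by (auto simp: elt_set_plus_def)
qed

lemma F_diff: "a \<in> F n \<Longrightarrow> b \<in> F n \<Longrightarrow> a - b \<in> F n"
  using F_add[of a n "- b"] F_uminus[of b n] by simp

lemma coset_subset:
  assumes "x \<in> a +o F n"
  shows "x +o F n \<subseteq> a +o F n"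
proof
  fix y assume "y \<in> x +o F n"
  then have "(y - x) + (x - a) \<in> F n"
    using assms by (intro F_add) (simp_all only: coset_iff)
  then show "y \<in> a +o F n" by (simp add: coset_iff)
qed

lemma coset_in_U: "a \<in> U \<Longrightarrow> a +o F n \<subseteq> U"
  using F_subset U_add by (auto simp: elt_set_plus_def)

lemma openin_iff: "openin filtration_topology S \<longleftrightarrow> S \<subseteq> U \<and> (\<forall>x\<in>S. \<exists>n\<ge>1. x +o F n \<subseteq> S)"
proof
  assume "openin filtration_topology S"
  then have "generate_topology_on {a +o F n | a n. a \<in> U \<and> n \<ge> 1} S"
    by (simp add: filtration_topology_def openin_topology_generated_by_iff)
  then show "S \<subseteq> U \<and> (\<forall>x\<in>S. \<exists>n\<ge>1. x +o F n \<subseteq> S)"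
  proof induction
    case (Int A B)
    have "\<exists>n\<ge>1. x +o F n \<subseteq> A \<inter> B" if x: "x \<in> A \<inter> B" for x
    proof -
      from Int x obtain n m where "1 \<le> n" "x +o F n \<subseteq> A" "1 \<le> m" "x +o F m \<subseteq> B" by blast
      moreover have "x +o F (max n m) \<subseteq> x +o F n" "x +o F (max n m) \<subseteq> x +o F m"
        using F_antimono[of n "max n m"] F_antimono[of m "max n m"] by (auto simp: coset_iff)
      ultimately show ?thesis by (intro exI[of _ "max n m"]) auto
    qed
    with Int show ?case by blast
  next
    case (UN K)
    then show ?case by (meson Sup_least Sup_upper2 UnionE)
  next
    case (Basis S)
    then obtain a n where S: "S = a +o F n" "a \<in> U" "1 \<le> n" by blast
    then show ?case
      using coset_in_U coset_subset by blast
  qed simp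
next
  assume S: "S \<subseteq> U \<and> (\<forall>x\<in>S. \<exists>n\<ge>1. x +o F n \<subseteq> S)"
  show "openin filtration_topology S"
  proof (subst openin_subopen, intro ballI)
    fix x assume "x \<in> S"
    with S obtain n where n: "1 \<le> n" "x +o F n \<subseteq> S" "x \<in> U" by blast
    then have "openin filtration_topology (x +o F n)"
      unfolding filtration_topology_def by (intro topology_generated_by_Basis) blast
    moreover have "x \<in> x +o F n"
      by (simp add: coset_iff F_zero)
    ultimately show "\<exists>V. openin filtration_topology V \<and> x \<in> V \<and> V \<subseteq> S"
      using n by blast
  qed
qed

lemma openin_coset: "a \<in> U \<Longrightarrow> 1 \<le> n \<Longrightarrow> openin filtration_topology (a +o F n)"
  unfolding filtration_topology_def by (intro topology_generated_by_Basis) blast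

lemma openin_U: "openin filtration_topology U"
  using coset_in_U by (auto simp: openin_iff intro!: exI[of _ 1])

lemma topspace_filtration_topology: "topspace filtration_topology = U"
  using openin_U openin_iff by (meson openin_subset openin_topspace subset_antisym)

lemma closedin_iff:
  "closedin filtration_topology S \<longleftrightarrow> S \<subseteq> U \<and> (\<forall>x\<in>U. (\<forall>n\<ge>1. \<exists>y\<in>S. y - x \<in> F n) \<longrightarrow> x \<in> S)"
proof -
  have "x +o F n \<subseteq> U - S \<longleftrightarrow> (\<forall>y\<in>S. y - x \<notin> F n)" if "x \<in> U" for x n
    using coset_in_U[OF that, of n] by (auto simp: coset_iff)
  then show ?thesis
    unfolding closedin_def topspace_filtration_topology openin_iff by blast
qed

lemma openin_subgroup:
  assumes "S \<subseteq> U" "\<And>a b. a \<in> S \<Longrightarrow> b \<in> S \<Longrightarrow> a + b \<in> S" "1 \<le> n" "F n \<subseteq> S"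
  shows "openin filtration_topology S"
  unfolding openin_iff using assms by (fastforce simp: elt_set_plus_def)

lemma openin_contains_F:
  assumes "openin filtration_topology S" "0 \<in> S"
  obtains n where "1 \<le> n" "F n \<subseteq> S"
proof -
  obtain n where "1 \<le> n" "0 +o F n \<subseteq> S"
    using assms by (auto simp: openin_iff)
  then show thesis
    using that[of n] by simp
qed

text \<open>The complement of an open subgroup is a union of its cosets.\<close>

lemma closedin_open_subgroup:
  assumes "openin filtration_topology S" "0 \<in> S" "\<And>a b. a \<in> S \<Longrightarrow> b \<in> S \<Longrightarrow> a - b \<in> S"
  shows "closedin filtration_topology S"
  unfolding closedin_iff
proof (intro conjI ballI impI)
  show "S \<subseteq> U" using assms(1) by (simp add: openin_iff)
  obtain n where n: "1 \<le> n" "F n \<subseteq> S"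
    using openin_contains_F assms(1,2) by blast
  fix x assume "x \<in> U" "\<forall>n\<ge>1. \<exists>y\<in>S. y - x \<in> F n"
  with n obtain y where "y \<in> S" "y - x \<in> S" by blast
  then have "y - (y - x) \<in> S" by (rule assms(3))
  then show "x \<in> S" by simp
qed

context
  assumes separated: "\<And>a. (\<And>n. 1 \<le> n \<Longrightarrow> a \<in> F n) \<Longrightarrow> a = 0"
begin

lemma Hausdorff: "Hausdorff_space filtration_topology"
  unfolding Hausdorff_space_def topspace_filtration_topology
proof (intro allI impI)
  fix x y assume xy: "x \<in> U \<and> y \<in> U \<and> x \<noteq> y"
  then obtain n where n: "1 \<le> n" "x - y \<notin> F n"
    using separated[of "x - y"] by auto
  have "disjnt (x +o F n) (y +o F n)"
    unfolding disjnt_iff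
  proof (intro allI notI)
    fix z assume "z \<in> x +o F n \<and> z \<in> y +o F n"
    then have "(z - y) - (z - x) \<in> F n"
      by (metis F_diff coset_iff)
    with n show False by simp
  qed
  then show "\<exists>A B. openin filtration_topology A \<and> openin filtration_topology B \<and> x \<in> A \<and> y \<in> B \<and> disjnt A B"
    using openin_coset[OF _ n(1)] xy by (metis F_zero coset_iff diff_self)
qed

lemma closedin_zero: "closedin filtration_topology {0}"
  unfolding closedin_iff
proof (intro conjI ballI impI)
  fix x assume "\<forall>n\<ge>1. \<exists>y\<in>{0}. y - x \<in> F n"
  then have "x \<in> F n" if "1 \<le> n" for n
    using F_uminus[of "- x" n] that by auto
  then show "x \<in> {0}" using separated by blast
qed (use F_zero F_subset in auto)

end

end

section \<open>The ideals of the completed Lie algebra\<close>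

lemma u_hat_from_iff: "a \<in> u_hat_from n \<longleftrightarrow> a \<in> u_hat \<and> (\<forall>i<n. a i = 0)"
  by (simp add: u_hat_from_def)

lemma u_hat_from_one: "u_hat_from (Suc 0) = u_hat"
  by (auto simp: u_hat_from_def u_hat_def)

lemma u_hat_coeff: "a \<in> u_hat \<Longrightarrow> a i \<in> P (i - 1)"
  by (cases "i = 0") (auto simp: u_hat_def)

lemma u_hat_add: "a \<in> u_hat \<Longrightarrow> b \<in> u_hat \<Longrightarrow> a + b \<in> u_hat"
  by (auto simp: u_hat_def P_add)

lemma u_hat_uminus: "a \<in> u_hat \<Longrightarrow> - a \<in> u_hat"
  by (auto simp: u_hat_def P_uminus)

lemma u_hat_zero: "0 \<in> u_hat"
  by (auto simp: u_hat_def)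

lemma u_hat_fscale: "a \<in> u_hat \<Longrightarrow> fscale c a \<in> u_hat"
  by (auto simp: u_hat_def fscale_def intro!: P_mult single_in_P)

lemma u_hat_from_zero: "0 \<in> u_hat_from n"
  by (auto simp: u_hat_from_iff u_hat_zero)

lemma u_hat_from_add: "a \<in> u_hat_from n \<Longrightarrow> b \<in> u_hat_from n \<Longrightarrow> a + b \<in> u_hat_from n"
  by (auto simp: u_hat_from_iff u_hat_add)

lemma u_hat_from_uminus: "a \<in> u_hat_from n \<Longrightarrow> - a \<in> u_hat_from n"
  by (auto simp: u_hat_from_iff u_hat_uminus)

lemma u_hat_from_diff: "a \<in> u_hat_from n \<Longrightarrow> b \<in> u_hat_from n \<Longrightarrow> a - b \<in> u_hat_from n"
  using u_hat_from_add[of a n "- b"] u_hat_from_uminus[of b n] by simp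

lemma u_hat_from_fscale: "a \<in> u_hat_from n \<Longrightarrow> fscale c a \<in> u_hat_from n"
  using u_hat_fscale[of a c] by (auto simp: u_hat_from_iff fscale_def)

lemma u_hat_from_antimono: "m \<le> n \<Longrightarrow> u_hat_from n \<subseteq> u_hat_from m"
  by (auto simp: u_hat_from_iff)

lemma u_hat_from_Suc_iff: "a \<in> u_hat_from (Suc n) \<longleftrightarrow> a \<in> u_hat_from n \<and> a n = 0"
  by (auto simp: u_hat_from_iff less_Suc_eq)

lemma u_hat_from_sep:
  assumes "\<And>n. 1 \<le> n \<Longrightarrow> a \<in> u_hat_from n"
  shows "a = 0"
proof
  fix i
  have "a \<in> u_hat_from (Suc i)" by (rule assms) simp
  then show "a i = 0 i" by (simp add: u_hat_from_iff)
qed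

definition field_term :: "nat \<Rightarrow> 'k::field_char_0 poly_inf \<Rightarrow> 'k formal_sum"
  where "field_term j q = (\<lambda>i. if i = j then q else 0)"

lemma field_term_in_u_hat_from: "1 \<le> j \<Longrightarrow> q \<in> P (j - 1) \<Longrightarrow> field_term j q \<in> u_hat_from j"
  by (auto simp: field_term_def u_hat_from_iff u_hat_def)

lemma field_term_in_u_hat: "1 \<le> j \<Longrightarrow> q \<in> P (j - 1) \<Longrightarrow> field_term j q \<in> u_hat"
  using field_term_in_u_hat_from by (auto simp: u_hat_from_iff)

lemma bracket_in_u_hat:
  assumes "a \<in> u_hat" "b \<in> u_hat"
  shows "bracket a b \<in> u_hat"
proof -
  have "a i * partial i (b j) - b i * partial i (a j) \<in> P (j - 1)" if "i < j" for i j
    using that assms u_hat_coeff P_mono[of "i - 1" "j - 1"]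
    by (intro P_diff P_mult partial_in_P) (auto simp: subset_iff)
  then show ?thesis
    unfolding u_hat_def bracket_def by (auto intro!: P_sum)
qed

text \<open>Up to its leading index, the bracket with \<open>b\<close> is differentiation of the coefficients of \<open>b\<close>:
  the terms that differentiate \<open>a\<close> carry a coefficient \<open>b i\<close> with \<open>i < n\<close>.\<close>

lemma bracket_below:
  assumes "b \<in> u_hat_from n" "k \<le> n"
  shows "bracket a b k = (\<Sum>i\<in>{1..<k}. a i * partial i (b k))"
  unfolding bracket_def using assms by (intro sum.cong) (auto simp: u_hat_from_iff)

lemma bracket_in_u_hat_from:
  assumes "a \<in> u_hat" "b \<in> u_hat_from n"
  shows "bracket a b \<in> u_hat_from n"
proof -
  have "bracket a b k = 0" if "k < n" for k
    using bracket_below[OF assms(2), of k] that assms(2) by (simp add: u_hat_from_iff)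
  then show ?thesis
    using assms bracket_in_u_hat by (auto simp: u_hat_from_iff)
qed

lemma bracket_field_term:
  assumes "b \<in> u_hat_from n" "1 \<le> j" "j < n"
  shows "bracket (field_term j q) b n = q * partial j (b n)"
proof -
  have "bracket (field_term j q) b n = (\<Sum>i\<in>{1..<n}. if i = j then q * partial j (b n) else 0)"
    unfolding bracket_below[OF assms(1) order_refl]
    by (intro sum.cong) (auto simp: field_term_def)
  then show ?thesis using assms by simp
qed

text \<open>The elements of \<open>u_hat_from n\<close> whose \<open>\<partial>\<^sub>n\<close>-coefficient only involves the given monomials:
  for \<open>D\<close> empty this is \<open>u_hat_from (n + 1)\<close>, and for \<open>D\<close> everything it is \<open>u_hat_from n\<close>.\<close>

definition lead_ideal :: "nat \<Rightarrow> exponent set \<Rightarrow> 'k::field_char_0 formal_sum set"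
  where "lead_ideal n D = {a \<in> u_hat_from n. Poly_Mapping.keys (a n) \<subseteq> D}"

lemma u_hat_from_Suc_subset_lead_ideal: "u_hat_from (Suc n) \<subseteq> lead_ideal n D"
  by (auto simp: lead_ideal_def u_hat_from_Suc_iff)

lemma lead_ideal_exponents:
  "lead_ideal n (exponents (n - 1)) = (u_hat_from n :: 'k::field_char_0 formal_sum set)"
proof -
  have "Poly_Mapping.keys (a n) \<subseteq> exponents (n - 1)" if "a \<in> u_hat" for a :: "'k formal_sum"
    using u_hat_coeff[OF that, of n] by (simp add: P_def)
  then show ?thesis
    unfolding lead_ideal_def u_hat_from_def by blast
qed

lemma keys_sum_subset:
  assumes "\<And>x. x \<in> A \<Longrightarrow> Poly_Mapping.keys (f x) \<subseteq> D"
  shows "Poly_Mapping.keys (sum f A) \<subseteq> D"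
  using assms
proof (induction A rule: infinite_finite_induct)
  case (insert x A)
  then have "Poly_Mapping.keys (f x) \<union> Poly_Mapping.keys (sum f A) \<subseteq> D" by blast
  then show ?case
    using insert keys_add[of "f x" "sum f A"] by (metis order_trans sum.insert)
qed auto

lemma lie_ideal_lead_ideal:
  assumes "initial n D"
  shows "lie_ideal u_hat (lead_ideal n D :: 'k::field_char_0 formal_sum set)"
  unfolding lie_ideal_def
proof (intro conjI ballI)
  show "(lead_ideal n D :: 'k formal_sum set) \<subseteq> u_hat"
    by (auto simp: lead_ideal_def u_hat_from_iff)
  show "formal.subspace (lead_ideal n D :: 'k formal_sum set)"
    unfolding formal.subspace_def
  proof (intro conjI ballI allI)
    show "0 \<in> lead_ideal n D" by (simp add: lead_ideal_def u_hat_from_zero)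
    fix a b :: "'k formal_sum" assume "a \<in> lead_ideal n D" "b \<in> lead_ideal n D"
    then show "a + b \<in> lead_ideal n D"
      using keys_add[of "a n" "b n"] u_hat_from_add[of a n b] by (auto simp: lead_ideal_def)
  next
    fix c and a :: "'k formal_sum" assume "a \<in> lead_ideal n D"
    then show "fscale c a \<in> lead_ideal n D"
      using u_hat_from_fscale[of a n c] by (auto simp: lead_ideal_def fscale_def in_keys_iff)
  qed
  fix a b :: "'k formal_sum" assume a: "a \<in> u_hat" and b: "b \<in> lead_ideal n D"
  then have bn: "b \<in> u_hat_from n" "Poly_Mapping.keys (b n) \<subseteq> D"
    by (auto simp: lead_ideal_def)
  have "Poly_Mapping.keys (a i * partial i (b n)) \<subseteq> D" if i: "i \<in> {1..<n}" for i
  proof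
    fix \<beta> assume "\<beta> \<in> Poly_Mapping.keys (a i * partial i (b n))"
    then obtain \<gamma> \<delta> where *: "\<gamma> \<in> Poly_Mapping.keys (a i)" "\<delta> \<in> Poly_Mapping.keys (b n)"
      "Poly_Mapping.lookup \<delta> i \<noteq> 0" "\<beta> = \<gamma> + (\<delta> - Poly_Mapping.single i 1)"
      by (rule keys_mult_partial)
    have "\<gamma> \<in> exponents (i - 1)" using * u_hat_coeff[OF a, of i] by (auto simp: P_def)
    moreover have "\<delta> \<in> D" "\<delta> \<in> exponents (n - 1)"
      using * bn assms by (auto simp: initial_iff)
    moreover have "1 \<le> i" "i \<le> n - 1" using i by auto
    ultimately have "exp_less n \<beta> \<delta>" "\<beta> \<in> exponents (n - 1)"
      unfolding \<open>\<beta> = _\<close> using *(3) by (blast intro: exp_less_shift shift_in_exponents)+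
    with \<open>\<delta> \<in> D\<close> show "\<beta> \<in> D"
      using assms unfolding initial_iff by blast
  qed
  then have "Poly_Mapping.keys (bracket a b n) \<subseteq> D"
    unfolding bracket_below[OF bn(1) order_refl] by (rule keys_sum_subset)
  then show "bracket a b \<in> lead_ideal n D"
    using bracket_in_u_hat_from[OF a bn(1)] by (simp add: lead_ideal_def)
qed

definition lead_coeffs :: "'k::field_char_0 formal_sum set \<Rightarrow> nat \<Rightarrow> 'k poly_inf set"
  where "lead_coeffs I n = (\<lambda>a. a n) ` (I \<inter> u_hat_from n)"

lemma lie_ideal_add: "lie_ideal L I \<Longrightarrow> a \<in> I \<Longrightarrow> b \<in> I \<Longrightarrow> a + b \<in> I"
  unfolding lie_ideal_def by (blast intro: formal.subspace_add)

lemma lie_ideal_diff: "lie_ideal L I \<Longrightarrow> a \<in> I \<Longrightarrow> b \<in> I \<Longrightarrow> a - b \<in> I"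
  unfolding lie_ideal_def by (blast intro: formal.subspace_diff)

lemma lie_ideal_uminus: "lie_ideal L I \<Longrightarrow> a \<in> I \<Longrightarrow> - a \<in> I"
  unfolding lie_ideal_def by (blast intro: formal.subspace_neg)

lemma lie_ideal_fscale: "lie_ideal L I \<Longrightarrow> a \<in> I \<Longrightarrow> fscale c a \<in> I"
  unfolding lie_ideal_def by (blast intro: formal.subspace_scale)

lemma lie_ideal_zero: "lie_ideal L I \<Longrightarrow> 0 \<in> I"
  unfolding lie_ideal_def by (blast intro: formal.subspace_0)

lemma lie_ideal_bracket: "lie_ideal L I \<Longrightarrow> a \<in> L \<Longrightarrow> b \<in> I \<Longrightarrow> bracket a b \<in> I"
  by (auto simp: lie_ideal_def)

lemma lie_ideal_subset: "lie_ideal L I \<Longrightarrow> I \<subseteq> L"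
  by (auto simp: lie_ideal_def)

lemma triangular_stable_lead_coeffs:
  assumes I: "lie_ideal u_hat (I :: 'k::field_char_0 formal_sum set)"
  shows "triangular_stable n (lead_coeffs I n)"
  unfolding triangular_stable_def
proof (intro conjI ballI allI impI)
  show "lead_coeffs I n \<subseteq> P (n - 1)"
    using u_hat_coeff by (auto simp: lead_coeffs_def u_hat_from_iff)
  show "0 \<in> lead_coeffs I n"
    unfolding lead_coeffs_def
    by (rule image_eqI[of _ _ 0]) (auto simp: lie_ideal_zero[OF I] u_hat_from_zero)
  fix f assume "f \<in> lead_coeffs I n"
  then obtain a where a: "a \<in> I" "a \<in> u_hat_from n" "f = a n" by (auto simp: lead_coeffs_def)
  show "Poly_Mapping.single 0 c * f \<in> lead_coeffs I n" for c
    unfolding lead_coeffs_def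
    by (rule image_eqI[of _ _ "fscale c a"])
      (auto simp: a fscale_def[of c a, THEN fun_cong] lie_ideal_fscale[OF I] u_hat_from_fscale)
  show "f + g \<in> lead_coeffs I n" if g: "g \<in> lead_coeffs I n" for g
  proof -
    obtain b where b: "b \<in> I" "b \<in> u_hat_from n" "g = b n"
      using g by (auto simp: lead_coeffs_def)
    show ?thesis
      unfolding lead_coeffs_def
      by (rule image_eqI[of _ _ "a + b"]) (auto simp: a b lie_ideal_add[OF I] u_hat_from_add)
  qed
  fix m and q :: "'k poly_inf" assume m: "1 \<le> m" "m \<le> n - 1" "q \<in> P (m - 1)"
  let ?b = "bracket (field_term m q) a"
  have "field_term m q \<in> u_hat" using m by (intro field_term_in_u_hat)
  then have "?b \<in> I" "?b \<in> u_hat_from n" "?b n = q * partial m f"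
    using a m lie_ideal_bracket[OF I] bracket_in_u_hat_from bracket_field_term[OF a(2), of m q] by auto
  then show "q * partial m f \<in> lead_coeffs I n"
    by (auto simp: lead_coeffs_def image_iff intro!: bexI[of _ ?b])
qed

text \<open>If \<open>a = \<partial>\<^sub>m + \<dots>\<close> is in the ideal, then so is \<open>[a, q \<partial>\<^sub>m\<^sub>+\<^sub>1] = \<partial>\<^sub>m(q) \<partial>\<^sub>m\<^sub>+\<^sub>1 + \<dots>\<close>, and
  every element of \<open>P m\<close> has an antiderivative \<open>q\<close> with respect to \<open>x\<^sub>m\<close>.\<close>

lemma lead_coeffs_Suc:
  fixes I :: "'k::field_char_0 formal_sum set"
  assumes I: "lie_ideal u_hat I" and m: "1 \<le> m" and one: "1 \<in> lead_coeffs I m"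
  shows "lead_coeffs I (Suc m) = P m"
proof
  show "lead_coeffs I (Suc m) \<subseteq> P m"
    using triangular_stable_lead_coeffs[OF I, of "Suc m"] by (simp add: triangular_stable_def)
  show "P m \<subseteq> lead_coeffs I (Suc m)"
  proof
    fix p :: "'k poly_inf" assume "p \<in> P m"
    then obtain q where q: "q \<in> P m" "partial m q = p"
      using antiderivative m by blast
    obtain a where a: "a \<in> I" "a \<in> u_hat_from m" "a m = 1"
      using one by (auto simp: lead_coeffs_def)
    have au: "a \<in> u_hat" using a(2) by (simp add: u_hat_from_iff)
    have t: "field_term (Suc m) q \<in> u_hat_from (Suc m)"
      using field_term_in_u_hat_from[of "Suc m" q] q by simp
    let ?b = "bracket (field_term (Suc m) q) a"
    have bI: "?b \<in> I"
      using lie_ideal_bracket[OF I _ a(1)] t by (simp add: u_hat_from_iff)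
    have anti: "- ?b = bracket a (field_term (Suc m) q)"
      by (rule ext) (simp add: bracket_def flip: sum_negf)
    have "a i * partial i q = (if i = m then p else 0)" if "i \<in> {1..<Suc m}" for i
      using that a q by (cases "i = m") (auto simp: u_hat_from_iff)
    then have "bracket a (field_term (Suc m) q) (Suc m) = (\<Sum>i\<in>{1..<Suc m}. if i = m then p else 0)"
      unfolding bracket_below[OF t order_refl]
      by (intro sum.cong) (auto simp: field_term_def)
    then have "(- ?b) (Suc m) = p"
      unfolding anti using m by simp
    moreover have "- ?b \<in> u_hat_from (Suc m)"
      unfolding anti by (rule bracket_in_u_hat_from[OF au t])
    ultimately show "p \<in> lead_coeffs I (Suc m)"
      using lie_ideal_uminus[OF I bI] by (auto simp: lead_coeffs_def image_iff intro!: bexI[of _ "- ?b"])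
  qed
qed

text \<open>The space of leading coefficients at \<open>\<partial>\<^sub>n\<close> is nonzero, so it contains the least monomial \<open>1\<close>, which
  starts an induction with the previous lemma.\<close>

lemma lead_coeffs_above:
  assumes I: "lie_ideal u_hat (I :: 'k::field_char_0 formal_sum set)"
    and a: "a \<in> I" "a \<in> u_hat_from n" "a n \<noteq> 0" and "1 \<le> n" "n < m"
  shows "lead_coeffs I m = P (m - 1)"
  using \<open>n < m\<close>
proof (induction m)
  case (Suc m)
  have "1 \<in> lead_coeffs I m"
  proof (cases "m = n")
    case False
    with Suc show ?thesis by auto
  next
    case True
    have V: "triangular_stable n (lead_coeffs I n)"
      by (rule triangular_stable_lead_coeffs[OF I])
    have an: "a n \<in> lead_coeffs I n" using a by (auto simp: lead_coeffs_def)
    obtain \<alpha> where "\<alpha> \<in> Poly_Mapping.keys (a n)" using a(3) by (meson all_not_in_conv keys_eq_empty)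
    then have \<alpha>: "\<alpha> \<in> exponents (n - 1)" "Poly_Mapping.single \<alpha> 1 \<in> lead_coeffs I n"
      using triangular_stable_monomial(2)[OF V] an by blast+
    have "(0, \<alpha>) \<in> exp_order n"
      using exp_order_total[OF \<alpha>(1) zero_in_exponents] by (auto simp: exp_order_def exp_less_def)
    then have "Poly_Mapping.single 0 1 \<in> lead_coeffs I n"
      using initialD[OF triangular_stable_monomial(1)[OF V]] \<alpha> by blast
    then show ?thesis using True by simp
  qed
  then show ?case
    using lead_coeffs_Suc[OF I] Suc.prems \<open>1 \<le> n\<close> by simp
qed simp

text \<open>Successive approximation: an element of the ideal removes the leading term of the error.  The
  ideal need not contain the infinite sum of these corrections, so this gives density only.\<close>

lemma approximate_by_ideal:
  assumes I: "lie_ideal u_hat (I :: 'k::field_char_0 formal_sum set)"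
    and full: "\<And>m. n \<le> m \<Longrightarrow> lead_coeffs I m = P (m - 1)"
    and x: "x \<in> u_hat_from n"
  shows "\<exists>y\<in>I. y - x \<in> u_hat_from (n + k)"
proof (induction k)
  case 0
  have "0 - x \<in> u_hat_from (n + 0)"
    using u_hat_from_uminus[OF x] by (simp only: diff_0 add_0_right)
  then show ?case
    using lie_ideal_zero[OF I] by (rule bexI)
next
  case (Suc k)
  then obtain y where y: "y \<in> I" "y - x \<in> u_hat_from (n + k)" by blast
  then have "(y - x) (n + k) \<in> P (n + k - 1)"
    using u_hat_coeff[of "y - x" "n + k"] by (simp only: u_hat_from_iff)
  then have "(y - x) (n + k) \<in> lead_coeffs I (n + k)"
    using full[of "n + k"] by simp
  then have "(y - x) (n + k) \<in> (\<lambda>a. a (n + k)) ` (I \<inter> u_hat_from (n + k))"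
    by (simp only: lead_coeffs_def)
  then obtain z where z: "(y - x) (n + k) = z (n + k)" "z \<in> I \<inter> u_hat_from (n + k)"
    by (rule imageE)
  have "(y - x) - z \<in> u_hat_from (n + k)"
    using y(2) z(2) by (blast intro: u_hat_from_diff)
  moreover have "((y - x) - z) (n + k) = 0"
    using z(1) by simp
  ultimately have "(y - x) - z \<in> u_hat_from (n + Suc k)"
    by (simp only: add_Suc_right u_hat_from_Suc_iff simp_thms)
  moreover have "(y - z) - x = (y - x) - z"
    by (simp only: diff_diff_eq add.commute)
  ultimately have "(y - z) - x \<in> u_hat_from (n + Suc k)"
    by (simp only:)
  moreover have "y - z \<in> I"
    using z(2) by (blast intro: lie_ideal_diff[OF I y(1)])
  ultimately show ?case
    by (rule bexI)
qed

interpretation u_hat_group: filtered_group "u_hat :: 'k::field_char_0 formal_sum set" u_hat_from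
proof
  show "u_hat_from n \<subseteq> u_hat" for n
    by (auto simp: u_hat_from_iff)
qed (fact u_hat_add u_hat_from_zero u_hat_from_add u_hat_from_uminus u_hat_from_antimono)+

lemma u_hat_top_eq: "u_hat_top = u_hat_group.filtration_topology"
  by (simp add: u_hat_top_def u_hat_group.filtration_topology_def)

text \<open>By the approximation, every element of the tail is a limit of elements of the ideal.\<close>

lemma closed_ideal_contains_tail:
  fixes I :: "'k::field_char_0 formal_sum set"
  assumes I: "lie_ideal u_hat I" and cl: "closedin u_hat_top I"
    and a: "a \<in> I" "a \<in> u_hat_from n" "a n \<noteq> 0"
  shows "u_hat_from (Suc n) \<subseteq> I"
proof
  have n: "1 \<le> n"
    using a by (cases n) (auto simp: u_hat_from_iff u_hat_def)
  fix x :: "'k formal_sum" assume x: "x \<in> u_hat_from (Suc n)"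
  have "\<exists>y\<in>I. y - x \<in> u_hat_from k" for k
  proof -
    have "lead_coeffs I m = P (m - 1)" if "Suc n \<le> m" for m
      using lead_coeffs_above[OF I a n] that by simp
    from approximate_by_ideal[OF I this x, of k]
    show ?thesis
      using u_hat_from_antimono[of k "Suc n + k"] by fastforce
  qed
  then show "x \<in> I"
    using cl x unfolding u_hat_top_eq u_hat_group.closedin_iff by (auto simp: u_hat_from_iff)
qed

lemma closed_ideal_structure:
  fixes I :: "'k::field_char_0 formal_sum set"
  assumes I: "lie_ideal u_hat I" and cl: "closedin u_hat_top I" and "I \<noteq> {0}"
  obtains n D where "1 \<le> n" "initial n D" "D \<noteq> {}" "I = lead_ideal n D"
proof -
  obtain a where a: "a \<in> I" "a \<noteq> 0"
    using \<open>I \<noteq> {0}\<close> lie_ideal_zero[OF I] by blast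
  then have ex: "\<exists>n. \<exists>a\<in>I. a n \<noteq> 0"
    by (auto simp: fun_eq_iff)
  \<comment> \<open>By minimality of this index, the ideal lies in \<open>u_hat_from n\<close>.\<close>
  define n where "n = (LEAST n. \<exists>a\<in>I. a n \<noteq> 0)"
  obtain b where b: "b \<in> I" "b n \<noteq> 0"
    using LeastI_ex[OF ex] by (auto simp: n_def)
  have In: "I \<subseteq> u_hat_from n"
  proof
    fix x assume "x \<in> I"
    then have "x k = 0" if "k < n" for k
      using not_less_Least[OF that[unfolded n_def]] by blast
    moreover have "x \<in> u_hat" using \<open>x \<in> I\<close> lie_ideal_subset[OF I] by blast
    ultimately show "x \<in> u_hat_from n" unfolding u_hat_from_iff by blast
  qed
  have tail: "u_hat_from (Suc n) \<subseteq> I"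
    using closed_ideal_contains_tail[OF I cl b(1) _ b(2)] In b by blast
  define V where "V = lead_coeffs I n"
  have V: "triangular_stable n V"
    unfolding V_def by (rule triangular_stable_lead_coeffs[OF I])
  obtain D where D: "initial n D" and VD: "V = {f. Poly_Mapping.keys f \<subseteq> D}"
    using triangular_stable_monomial[OF V] by blast
  show thesis
  proof (rule that)
    show "1 \<le> n"
    proof -
      have "b 0 = 0" using b lie_ideal_subset[OF I] unfolding u_hat_def by blast
      with b(2) show ?thesis by (cases n) simp_all
    qed
    show "initial n D" by (rule D)
    have "b n \<in> V" using b In by (auto simp: V_def lead_coeffs_def)
    then have "Poly_Mapping.keys (b n) \<subseteq> D" using VD by blast
    moreover have "Poly_Mapping.keys (b n) \<noteq> {}" using b by simp
    ultimately show "D \<noteq> {}" by blast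
    show "I = lead_ideal n D"
    proof (intro set_eqI iffI)
      fix x assume "x \<in> I"
      then have "x \<in> u_hat_from n" "x n \<in> V"
        using In unfolding V_def lead_coeffs_def by blast+
      then show "x \<in> lead_ideal n D"
        using VD by (auto simp: lead_ideal_def)
    next
      fix x :: "'k formal_sum" assume x: "x \<in> lead_ideal n D"
      then have "x n \<in> (\<lambda>a. a n) ` (I \<inter> u_hat_from n)"
        using VD unfolding V_def lead_ideal_def lead_coeffs_def by blast
      then obtain y where y: "y \<in> I" "y \<in> u_hat_from n" "x n = y n"
        by blast
      have "x - y \<in> u_hat_from (Suc n)"
        using x y u_hat_from_diff[of x n y] by (auto simp: lead_ideal_def u_hat_from_Suc_iff)
      then have "(x - y) + y \<in> I"
        using tail y lie_ideal_add[OF I] by blast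
      then show "x \<in> I" by simp
    qed
  qed
qed

section \<open>Ordinals as initial segments\<close>

lemma ord_elt_eq: "ord_elt n \<alpha> = Restr (exp_order n) (under (exp_order n) \<alpha>)"
  by (simp add: ord_elt_def under_def)

text \<open>The order type of \<open>\<alpha>\<close> counts \<open>\<alpha>\<close> itself, so it is that of the closed segment below \<open>\<alpha>\<close>; and initial
  segments of a well-order are compared by inclusion.\<close>

lemma exponents_ordLeq_initial:
  assumes D: "initial n D" and iso: "(l, Restr (exp_order n) D) \<in> ordIso"
  shows "{\<alpha> \<in> exponents (n - 1). (ord_elt n \<alpha>, l) \<in> ordLeq} = D"
proof -
  have "(ord_elt n \<alpha>, l) \<in> ordLeq \<longleftrightarrow> \<alpha> \<in> D" if \<alpha>: "\<alpha> \<in> exponents (n - 1)" for \<alpha>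
  proof -
    have "(ord_elt n \<alpha>, l) \<in> ordLeq \<longleftrightarrow> (ord_elt n \<alpha>, Restr (exp_order n) D) \<in> ordLeq"
      using iso by (meson ordIso_symmetric ordLeq_ordIso_trans)
    also have "\<dots> \<longleftrightarrow> under (exp_order n) \<alpha> \<subseteq> D"
      unfolding ord_elt_eq
      by (rule ofilter_subset_ordLeq[symmetric, OF Well_order_exp_order _ D])
        (rule wo_rel.under_ofilter[OF wo_rel_exp_order])
    also have "\<dots> \<longleftrightarrow> \<alpha> \<in> D"
    proof
      assume "under (exp_order n) \<alpha> \<subseteq> D"
      then show "\<alpha> \<in> D"
        using \<alpha> by (auto simp: under_def exp_order_def)
    next
      assume "\<alpha> \<in> D"
      then show "under (exp_order n) \<alpha> \<subseteq> D"
        using D unfolding wo_rel.ofilter_def[OF wo_rel_exp_order] by blast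
    qed
    finally show ?thesis .
  qed
  then show ?thesis
    using D unfolding initial_iff by blast
qed

text \<open>An ordinal strictly below a well-order is the type of the segment strictly below some point; that
  point is missing from the segment.\<close>

lemma ordinal_initial:
  assumes "l \<in> ordinals_from_1_below (omega_power (n - 1))"
  obtains D where "initial n D" "D \<noteq> exponents (n - 1)" "(l, Restr (exp_order n) D) \<in> ordIso"
proof -
  have "(l, omega_power (n - 1)) \<in> ordLess"
    using assms by (simp add: ordinals_from_1_below_def)
  then have less: "(l, exp_order n) \<in> ordLess"
    by (rule ordLess_ordIso_trans) (rule ordIso_symmetric[OF exp_order_ordIso])
  then have "Well_order l" by (auto simp: ordLess_def)
  then obtain \<alpha> where \<alpha>: "\<alpha> \<in> Field (exp_order n)"
    "(l, Restr (exp_order n) (underS (exp_order n) \<alpha>)) \<in> ordIso"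
    using less ordLess_iff_ordIso_Restr[OF Well_order_exp_order] by blast
  show thesis
  proof (rule that[OF _ _ \<alpha>(2)])
    show "initial n (underS (exp_order n) \<alpha>)"
      by (rule wo_rel.underS_ofilter[OF wo_rel_exp_order])
    show "underS (exp_order n) \<alpha> \<noteq> exponents (n - 1)"
      using \<alpha>(1) unfolding Field_exp_order by (auto simp: underS_def)
  qed
qed

lemma initial_ordinal:
  assumes D: "initial n D" "D \<noteq> {}" "D \<noteq> exponents (n - 1)"
  obtains l where "l \<in> ordinals_from_1_below (omega_power (n - 1))"
    "(l, Restr (exp_order n) D) \<in> ordIso"
proof -
  let ?r = "Restr (exp_order n) D" and ?f = "to_nat \<circ> exponent_list (n - 1)"
  have wo: "Well_order ?r"
    by (rule Well_order_Restr[OF Well_order_exp_order])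
  have F: "Field ?r = D"
    by (rule Field_Restr_ofilter[OF Well_order_exp_order D(1)])
  have "inj_on (exponent_list (n - 1)) D"
    using bij_betw_imp_inj_on[OF exponent_list_bij] D(1) unfolding initial_iff
    by (blast intro: inj_on_subset)
  then have inj: "inj_on ?f (Field ?r)"
    unfolding F by (intro comp_inj_on) (auto intro: inj_on_subset[OF inj_to_nat])
  \<comment> \<open>Ordinals are relations on \<^typ>\<open>nat\<close>, so the order on \<open>D\<close> is transported along an injection of
    the exponents into the natural numbers.\<close>
  define l where "l = dir_image ?r ?f"
  have iso: "(?r, l) \<in> ordIso"
    unfolding l_def by (rule dir_image_ordIso[OF wo inj])
  have wol: "Well_order l"
    unfolding l_def by (rule Well_order_dir_image[OF wo inj])
  have "(?r, exp_order n) \<in> ordLess"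
    using ofilter_ordLess[OF Well_order_exp_order D(1)] D(1,3)
    unfolding initial_iff Field_exp_order by blast
  then have "(l, omega_power (n - 1)) \<in> ordLess"
    using iso exp_order_ordIso by (meson ordIso_ordLess_trans ordIso_symmetric ordLess_ordIso_trans)
  moreover have "(natLeq_on 1, l) \<in> ordLeq"
  proof -
    have "\<not> (l, natLeq_on 1) \<in> ordLess"
    proof
      assume "(l, natLeq_on 1) \<in> ordLess"
      then obtain a where a: "a \<in> Field (natLeq_on 1)"
        "(l, Restr (natLeq_on 1) (underS (natLeq_on 1) a)) \<in> ordIso"
        using ordLess_iff_ordIso_Restr[OF natLeq_on_Well_order wol] by blast
      have "Restr (natLeq_on 1) (underS (natLeq_on 1) a) = {}"
        by (auto simp: underS_def)
      then have "(l, {} :: nat rel) \<in> ordIso" using a(2) by simp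
      then obtain f where "iso l ({} :: nat rel) f" unfolding ordIso_def by blast
      then have "Field l = {}"
        by (auto simp: iso_def bij_betw_def)
      then show False
        using D(2) F unfolding l_def dir_image_Field by simp
    qed
    then show ?thesis
      using not_ordLess_iff_ordLeq[OF natLeq_on_Well_order wol] by blast
  qed
  ultimately show thesis
    using that[of l] iso ordIso_symmetric by (auto simp: ordinals_from_1_below_def)
qed

section \<open>The ideals attached to ordinals\<close>

lemma fscale_basis_elt: "fscale c (basis_elt n \<alpha>) = field_term n (Poly_Mapping.single \<alpha> c)"
  by (auto simp: fscale_def basis_elt_def field_term_def mult_single fun_eq_iff)

lemma field_term_sum: "field_term n (sum f A) = (\<Sum>x\<in>A. field_term n (f x))"
proof -
  have "field_term n (p + q) = field_term n p + field_term n q" for p q :: "'a poly_inf"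
    by (auto simp: field_term_def fun_eq_iff)
  moreover have "field_term n 0 = (0 :: 'a formal_sum)"
    by (auto simp: field_term_def fun_eq_iff)
  ultimately show ?thesis
    by (induction A rule: infinite_finite_induct) simp_all
qed

lemma span_basis_elts:
  "formal.span {basis_elt n \<alpha> | \<alpha>. \<alpha> \<in> D} =
    {field_term n f | f :: 'k::field_char_0 poly_inf. Poly_Mapping.keys f \<subseteq> D}" (is "?S = ?T")
proof
  have "formal.subspace ?T"
    unfolding formal.subspace_def
  proof (intro conjI ballI allI)
    show "0 \<in> ?T"
      by (auto simp: field_term_def fun_eq_iff intro!: exI[of _ 0])
    fix x assume "x \<in> ?T"
    then obtain f where f: "x = field_term n f" "Poly_Mapping.keys f \<subseteq> D" by blast
    show "fscale c x \<in> ?T" for c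
      using f by (auto simp: field_term_def fscale_def fun_eq_iff in_keys_iff
          intro!: exI[of _ "Poly_Mapping.single 0 c * f"])
    fix y assume "y \<in> ?T"
    then obtain g where g: "y = field_term n g" "Poly_Mapping.keys g \<subseteq> D" by blast
    have "Poly_Mapping.keys (f + g) \<subseteq> D"
      using f g keys_add[of f g] by blast
    then show "x + y \<in> ?T"
      using f(1) g(1) by (auto simp: field_term_def fun_eq_iff intro!: exI[of _ "f + g"])
  qed
  moreover have "{basis_elt n \<alpha> | \<alpha>. \<alpha> \<in> D} \<subseteq> ?T"
  proof
    fix x :: "'k formal_sum" assume "x \<in> {basis_elt n \<alpha> | \<alpha>. \<alpha> \<in> D}"
    then obtain \<alpha> where "x = basis_elt n \<alpha>" "\<alpha> \<in> D" by blast
    then have "x = field_term n (Poly_Mapping.single \<alpha> 1)" "Poly_Mapping.keys (Poly_Mapping.single \<alpha> (1::'k)) \<subseteq> D"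
      by (simp_all add: basis_elt_def field_term_def)
    then show "x \<in> ?T" by blast
  qed
  ultimately show "?S \<subseteq> ?T"
    by (intro formal.span_minimal)
  show "?T \<subseteq> ?S"
  proof
    fix x assume "x \<in> ?T"
    then obtain f where f: "x = field_term n f" "Poly_Mapping.keys f \<subseteq> D" by blast
    have "x = (\<Sum>\<alpha>\<in>Poly_Mapping.keys f. fscale (Poly_Mapping.lookup f \<alpha>) (basis_elt n \<alpha>))"
      unfolding fscale_basis_elt field_term_sum[symmetric] sum_monomials f(1) ..
    also have "\<dots> \<in> ?S"
      using f(2) by (intro formal.span_sum formal.span_scale formal.span_base) blast
    finally show "x \<in> ?S" .
  qed
qed

lemma field_terms_plus_tail:
  assumes "1 \<le> n" "D \<subseteq> exponents (n - 1)"
  shows "{field_term n f | f. Poly_Mapping.keys f \<subseteq> D} + u_hat_from (Suc n) =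
    (lead_ideal n D :: 'k::field_char_0 formal_sum set)" (is "?T + _ = _")
proof (intro set_eqI iffI)
  fix x :: "'k formal_sum" assume "x \<in> ?T + u_hat_from (Suc n)"
  then obtain f b where x: "x = field_term n f + b" "Poly_Mapping.keys f \<subseteq> D" "b \<in> u_hat_from (Suc n)"
    by (auto simp: set_plus_def)
  have "field_term n f \<in> u_hat_from n"
    using x(2) assms by (intro field_term_in_u_hat_from) (auto simp: P_def)
  moreover have "b \<in> u_hat_from n" "b n = 0"
    using x(3) by (simp_all add: u_hat_from_Suc_iff)
  ultimately show "x \<in> lead_ideal n D"
    using x(1,2) u_hat_from_add[of "field_term n f" n b]
    by (simp add: lead_ideal_def field_term_def)
next
  fix x :: "'k formal_sum" assume x: "x \<in> lead_ideal n D"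
  let ?t = "field_term n (x n)"
  have "?t \<in> u_hat_from n"
    using x assms by (intro field_term_in_u_hat_from) (auto simp: P_def lead_ideal_def)
  then have "x - ?t \<in> u_hat_from n"
    using x by (intro u_hat_from_diff) (auto simp: lead_ideal_def)
  moreover have "(x - ?t) n = 0"
    by (simp add: field_term_def)
  ultimately have "x - ?t \<in> u_hat_from (Suc n)"
    unfolding u_hat_from_Suc_iff by blast
  moreover have "?t \<in> ?T"
    using x by (auto simp: lead_ideal_def)
  ultimately have "?t + (x - ?t) \<in> ?T + u_hat_from (Suc n)"
    by (intro set_plus_intro)
  then show "x \<in> ?T + u_hat_from (Suc n)"
    by (simp only: add_diff_eq add_diff_cancel_left')
qed

lemma I_ideal_eq_lead_ideal:
  assumes "1 \<le> n" "initial n D" "(l, Restr (exp_order n) D) \<in> ordIso"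
  shows "I_ideal l n = (lead_ideal n D :: 'k::field_char_0 formal_sum set)"
proof -
  have D: "D \<subseteq> exponents (n - 1)" using assms(2) by (simp add: initial_iff)
  have "{basis_elt n \<alpha> | \<alpha>. \<alpha> \<in> exponents (n - 1) \<and> (ord_elt n \<alpha>, l) \<in> ordLeq} =
      {basis_elt n \<alpha> :: 'k formal_sum | \<alpha>. \<alpha> \<in> {\<alpha> \<in> exponents (n - 1). (ord_elt n \<alpha>, l) \<in> ordLeq}}"
    by blast
  also have "\<dots> = {basis_elt n \<alpha> | \<alpha>. \<alpha> \<in> D}"
    unfolding exponents_ordLeq_initial[OF assms(2,3)] ..
  finally have "I_ord l n = {field_term n f | f :: 'k poly_inf. Poly_Mapping.keys f \<subseteq> D}"
    unfolding I_ord_def by (simp only: span_basis_elts)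
  then show ?thesis
    unfolding I_ideal_def by (simp only: Suc_eq_plus1[symmetric] field_terms_plus_tail[OF assms(1) D])
qed

section \<open>Open and closed ideals\<close>

text \<open>For \<open>n = 1\<close> the only monomial is \<open>1\<close>, so the only nonempty segment is the full one, and it gives
  the whole algebra.\<close>

lemma lead_ideal_cases:
  assumes n: "1 \<le> n" and D: "initial n D" "D \<noteq> {}"
  shows "(lead_ideal n D :: 'k::field_char_0 formal_sum set) \<in> {u_hat} \<union> {u_hat_from n | n. n \<ge> 2} \<union>
        {I_ideal l n | l n. n \<ge> 2 \<and> l \<in> ordinals_from_1_below (omega_power (n - 1))}"
proof (cases "D = exponents (n - 1)")
  case True
  then have "lead_ideal n D = (u_hat_from n :: 'k formal_sum set)"
    by (simp only: lead_ideal_exponents)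
  moreover have "n = Suc 0 \<or> 2 \<le> n" using n by linarith
  ultimately show ?thesis
    using u_hat_from_one by blast
next
  case False
  have "2 \<le> n"
  proof (rule ccontr)
    assume "\<not> 2 \<le> n"
    then have "exponents (n - 1) = {0}"
      using n by (auto simp: exponents_def)
    with D False show False by (auto simp: initial_iff)
  qed
  moreover obtain l where "l \<in> ordinals_from_1_below (omega_power (n - 1))"
    "(l, Restr (exp_order n) D) \<in> ordIso"
    using initial_ordinal[OF D False] by blast
  moreover from this have "lead_ideal n D = (I_ideal l n :: 'k formal_sum set)"
    by (intro I_ideal_eq_lead_ideal[OF n D(1), symmetric])
  ultimately show ?thesis by blast
qed

lemma lead_ideal_of_cases:
  fixes I :: "'k::field_char_0 formal_sum set"
  assumes "I \<in> {u_hat} \<union> {u_hat_from n | n. n \<ge> 2} \<union>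
        {I_ideal l n | l n. n \<ge> 2 \<and> l \<in> ordinals_from_1_below (omega_power (n - 1))}"
  obtains n D where "1 \<le> n" "initial n D" "I = lead_ideal n D"
proof -
  note witness = that
  have tail: thesis if "1 \<le> n" "I = u_hat_from n" for n
    using that(2) witness[OF that(1) initial_exponents] by (simp only: lead_ideal_exponents)
  consider "I = u_hat" | n where "2 \<le> n" "I = u_hat_from n"
    | l n where "2 \<le> n" "l \<in> ordinals_from_1_below (omega_power (n - 1))" "I = I_ideal l n"
    using assms by blast
  then show thesis
  proof cases
    case 1
    then show ?thesis
      using tail[of "Suc 0"] by (simp add: u_hat_from_one)
  next
    case (2 n)
    then show ?thesis
      using tail[of n] by simp
  next
    case (3 l n)
    then have "1 \<le> n" by simp
    obtain D where D: "initial n D" "(l, Restr (exp_order n) D) \<in> ordIso"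
      using ordinal_initial[OF 3(2)] by blast
    show ?thesis
      using witness[OF \<open>1 \<le> n\<close> D(1)] 3(3)
      by (simp only: I_ideal_eq_lead_ideal[OF \<open>1 \<le> n\<close> D])
  qed
qed

lemma u_hat_from_nontrivial: "1 \<le> n \<Longrightarrow> \<exists>a \<in> u_hat_from n. a \<noteq> (0 :: 'k::field_char_0 formal_sum)"
  by (rule bexI[of _ "field_term n 1"])
    (auto simp: field_term_def fun_eq_iff intro: field_term_in_u_hat_from[unfolded field_term_def])

lemma not_openin_zero: "\<not> openin u_hat_top ({0} :: 'k::field_char_0 formal_sum set)"
proof
  assume "openin u_hat_top ({0} :: 'k formal_sum set)"
  then obtain n where "1 \<le> n" "u_hat_from n \<subseteq> ({0} :: 'k formal_sum set)"
    unfolding u_hat_top_eq using u_hat_group.openin_contains_F by blast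
  then show False using u_hat_from_nontrivial by blast
qed

lemma lead_ideal_open:
  assumes D: "initial n D"
  shows "openin u_hat_top (lead_ideal n D :: 'k::field_char_0 formal_sum set)"
proof -
  note I = lie_ideal_lead_ideal[OF D]
  show ?thesis
    unfolding u_hat_top_eq
    using lie_ideal_subset[OF I] lie_ideal_add[OF I] _ u_hat_from_Suc_subset_lead_ideal
    by (rule u_hat_group.openin_subgroup) simp_all
qed

lemma open_ideal_closed:
  assumes "lie_ideal u_hat I" "openin u_hat_top I"
  shows "closedin u_hat_top I"
  using assms unfolding u_hat_top_eq
  by (intro u_hat_group.closedin_open_subgroup lie_ideal_zero lie_ideal_diff)

lemma open_ideal_iff_closed:
  fixes I :: "'k::field_char_0 formal_sum set"
  assumes I: "lie_ideal u_hat I"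
  shows "openin u_hat_top I \<longleftrightarrow> I \<noteq> {0} \<and> closedin u_hat_top I"
proof
  assume "openin u_hat_top I"
  then show "I \<noteq> {0} \<and> closedin u_hat_top I"
    using not_openin_zero open_ideal_closed[OF I] by blast
next
  assume "I \<noteq> {0} \<and> closedin u_hat_top I"
  then obtain n D where "initial n D" "I = lead_ideal n D"
    using closed_ideal_structure[OF I] by blast
  then show "openin u_hat_top I"
    using lead_ideal_open by blast
qed

text \<open>A monomial outside \<open>D\<close> witnesses that the tail starting at \<open>n\<close> is not contained in the ideal.\<close>

lemma u_hat_from_subset_lead_ideal_iff:
  assumes n: "1 \<le> n" and D: "initial n D" "D \<noteq> exponents (n - 1)"
  shows "u_hat_from (m + 1) \<subseteq> (lead_ideal n D :: 'k::field_char_0 formal_sum set) \<longleftrightarrow> n \<le> m"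
proof
  assume "n \<le> m"
  then have "(u_hat_from (m + 1) :: 'k formal_sum set) \<subseteq> u_hat_from (Suc n)"
    by (intro u_hat_from_antimono) simp
  then show "u_hat_from (m + 1) \<subseteq> (lead_ideal n D :: 'k formal_sum set)"
    using u_hat_from_Suc_subset_lead_ideal by blast
next
  assume sub: "u_hat_from (m + 1) \<subseteq> (lead_ideal n D :: 'k formal_sum set)"
  show "n \<le> m"
  proof (rule ccontr)
    assume "\<not> n \<le> m"
    then have "(u_hat_from n :: 'k formal_sum set) \<subseteq> u_hat_from (m + 1)"
      by (intro u_hat_from_antimono) simp
    with sub have sub': "(u_hat_from n :: 'k formal_sum set) \<subseteq> lead_ideal n D" by blast
    obtain \<alpha> where \<alpha>: "\<alpha> \<in> exponents (n - 1)" "\<alpha> \<notin> D"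
      using D unfolding initial_iff by blast
    have "field_term n (Poly_Mapping.single \<alpha> (1 :: 'k)) \<in> u_hat_from n"
      by (intro field_term_in_u_hat_from n single_in_P \<alpha>)
    with sub' have "field_term n (Poly_Mapping.single \<alpha> (1 :: 'k)) \<in> lead_ideal n D" by blast
    with \<alpha>(2) show False
      by (simp add: lead_ideal_def field_term_def)
  qed
qed

lemma u_inf_add: "a \<in> u_inf \<Longrightarrow> b \<in> u_inf \<Longrightarrow> a + b \<in> u_inf"
proof -
  assume "a \<in> u_inf" "b \<in> u_inf"
  then obtain m n where "2 \<le> m" "a \<in> u_fin m" "b \<in> u_fin n"
    by (auto simp: u_inf_def)
  then have "2 \<le> max m n" "a + b \<in> u_fin (max m n)"
    by (auto simp: u_fin_def u_hat_add)
  then show "a + b \<in> u_inf" by (auto simp: u_inf_def)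
qed

lemma u_inf_uminus: "a \<in> u_inf \<Longrightarrow> - a \<in> u_inf"
  by (auto simp: u_inf_def u_fin_def u_hat_uminus)

lemma u_inf_from_iff: "a \<in> u_inf_from n \<longleftrightarrow> a \<in> u_inf \<and> a \<in> u_hat_from n"
  by (auto simp: u_inf_from_def u_hat_from_iff u_inf_def u_fin_def)

interpretation u_inf_group: filtered_group "u_inf :: 'k::field_char_0 formal_sum set" u_inf_from
proof
  have "0 \<in> (u_inf :: 'k formal_sum set)"
    by (auto simp: u_inf_def u_fin_def u_hat_zero)
  then show "0 \<in> (u_inf_from n :: 'k formal_sum set)" for n
    by (simp add: u_inf_from_iff u_hat_from_zero)
  show "u_inf_from n \<subseteq> u_inf" for n
    unfolding u_inf_from_def by blast
  show "u_inf_from n \<subseteq> u_inf_from m" if "m \<le> n" for m n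
    using u_hat_from_antimono[OF that] unfolding u_inf_from_iff subset_iff by blast
  show "a + b \<in> u_inf_from n" if "a \<in> u_inf_from n" "b \<in> u_inf_from n" for n and a b :: "'k formal_sum"
    using that unfolding u_inf_from_iff by (blast intro: u_inf_add u_hat_from_add)
  show "- a \<in> u_inf_from n" if "a \<in> u_inf_from n" for n and a :: "'k formal_sum"
    using that unfolding u_inf_from_iff by (blast intro: u_inf_uminus u_hat_from_uminus)
qed (fact u_inf_add)

lemma Hausdorff_u_hat: "Hausdorff_space (u_hat_top :: 'k::field_char_0 formal_sum topology)"
  unfolding u_hat_top_eq by (rule u_hat_group.Hausdorff) (rule u_hat_from_sep)

lemma Hausdorff_u_inf: "Hausdorff_space (u_inf_top :: 'k::field_char_0 formal_sum topology)"
  unfolding u_inf_top_def u_inf_group.filtration_topology_def[symmetric]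
  by (rule u_inf_group.Hausdorff) (simp only: u_inf_from_iff u_hat_from_sep)

lemma closedin_u_hat_zero: "closedin u_hat_top ({0} :: 'k::field_char_0 formal_sum set)"
  unfolding u_hat_top_eq by (rule u_hat_group.closedin_zero) (rule u_hat_from_sep)

lemma lie_ideal_zero_ideal: "lie_ideal u_hat ({0} :: 'k::field_char_0 formal_sum set)"
proof -
  have "bracket a 0 = (0 :: 'k formal_sum)" for a
    by (rule ext) (simp add: bracket_def)
  then show ?thesis
    unfolding lie_ideal_def by (auto simp: u_hat_zero formal.subspace_single_0)
qed

theorem theorem7p2:
  shows
    "({I :: 'k::field_char_0 formal_sum set. lie_ideal u_hat I \<and> openin u_hat_top I} =
        {I. lie_ideal u_hat I \<and> I \<noteq> {0} \<and> closedin u_hat_top I} \<and>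
      {I :: 'k formal_sum set. lie_ideal u_hat I \<and> openin u_hat_top I} =
        {u_hat} \<union> {u_hat_from n | n. n \<ge> 2} \<union>
        {I_ideal l n | l n. n \<ge> 2 \<and> l \<in> ordinals_from_1_below (omega_power (n - 1))} \<and>
      (\<forall>I :: 'k formal_sum set. lie_ideal u_hat I \<and> I \<noteq> {0} \<and> closedin u_hat_top I \<longrightarrow>
        (\<exists>n'\<ge>2. u_hat_from (n' + 1) \<subseteq> I)) \<and>
      (\<forall>n\<ge>2. \<forall>l \<in> ordinals_from_1_below (omega_power (n - 1)).
        n = (LEAST n'. n' \<ge> 2 \<and> u_hat_from (n' + 1) \<subseteq> (I_ideal l n :: 'k formal_sum set))))
     \<and>
     (\<forall>I :: 'k formal_sum set. lie_ideal u_hat I \<and> I \<noteq> {0} \<longrightarrow>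
        (openin u_hat_top I \<longleftrightarrow> closedin u_hat_top I))
     \<and>
     (Hausdorff_space (u_inf_top :: 'k formal_sum topology) \<and>
      Hausdorff_space (u_hat_top :: 'k formal_sum topology))
     \<and>
     (lie_ideal u_hat ({0} :: 'k formal_sum set) \<and>
      closedin u_hat_top ({0} :: 'k formal_sum set) \<and>
      \<not> openin u_hat_top ({0} :: 'k formal_sum set))"
    (is "(?open = ?closed \<and> ?open = ?list \<and> ?tails \<and> ?least) \<and> ?iff \<and> ?hausdorff \<and> ?zero")
proof (intro conjI)
  show "?open = ?closed" and ?iff
    using open_ideal_iff_closed by blast+
  show "?open = ?list"
  proof (intro set_eqI iffI)
    fix I assume "I \<in> ?open"
    then have I: "lie_ideal u_hat I" "closedin u_hat_top I" "I \<noteq> {0}"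
      using open_ideal_iff_closed by blast+
    obtain n D where "1 \<le> n" "initial n D" "D \<noteq> {}" "I = lead_ideal n D"
      using closed_ideal_structure[OF I] .
    then show "I \<in> ?list"
      using lead_ideal_cases by simp
  next
    fix I assume "I \<in> ?list"
    then obtain n D where "1 \<le> n" "initial n D" "I = lead_ideal n D"
      by (rule lead_ideal_of_cases)
    then show "I \<in> ?open"
      using lie_ideal_lead_ideal lead_ideal_open by blast
  qed
  show ?tails
  proof (intro allI impI)
    fix I :: "'k formal_sum set" assume "lie_ideal u_hat I \<and> I \<noteq> {0} \<and> closedin u_hat_top I"
    then obtain n D where "1 \<le> n" "I = lead_ideal n D"
      using closed_ideal_structure by blast
    then have "u_hat_from (n + 1 + 1) \<subseteq> I"
      using u_hat_from_Suc_subset_lead_ideal[of n D] u_hat_from_antimono[of "Suc n" "n + 1 + 1"]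
      by fastforce
    with \<open>1 \<le> n\<close> show "\<exists>n'\<ge>2. u_hat_from (n' + 1) \<subseteq> I"
      by (intro exI[of _ "n + 1"]) simp
  qed
  show ?least
  proof (intro allI impI ballI)
    fix n l assume n: "2 \<le> n" and l: "l \<in> ordinals_from_1_below (omega_power (n - 1))"
    then have n1: "1 \<le> n" by simp
    obtain D where D: "initial n D" "D \<noteq> exponents (n - 1)" "(l, Restr (exp_order n) D) \<in> ordIso"
      using ordinal_initial[OF l] .
    show "n = (LEAST n'. n' \<ge> 2 \<and> u_hat_from (n' + 1) \<subseteq> (I_ideal l n :: 'k formal_sum set))"
      unfolding I_ideal_eq_lead_ideal[OF n1 D(1,3)] u_hat_from_subset_lead_ideal_iff[OF n1 D(1,2)]
      using n by (intro Least_equality[symmetric]) auto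
  qed
  show "Hausdorff_space (u_inf_top :: 'k formal_sum topology)"
    by (rule Hausdorff_u_inf)
  show "Hausdorff_space (u_hat_top :: 'k formal_sum topology)"
    by (rule Hausdorff_u_hat)
  show "lie_ideal u_hat ({0} :: 'k formal_sum set)"
    by (rule lie_ideal_zero_ideal)
  show "closedin u_hat_top ({0} :: 'k formal_sum set)"
    by (rule closedin_u_hat_zero)
  show "\<not> openin u_hat_top ({0} :: 'k formal_sum set)"
    by (rule not_openin_zero)
qed

end
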